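(* Let $k\ge 1$, let $\mathcal I$ be a complete marriage instance with men $m_1,\dots,m_k$ and women $w_1,\dots,w_k$, $n=2k$, and let $A,b,C$ be as in the context. If Scarf's algorithm on input $(A,b,C)$ performs every cardinal pivot according to the following rule, then it terminates after $O(n^2)$ iterations. Rule: let $B$ be the current feasible basis, $D$ the current ordinal basis with utility vector $u$, and $j_t$ the unique element of $D\setminus B$ (the column entering $B$). If $u_1\in\{k+1,\dots,k^2\}$, let $m_i$ be the separator of $D$; otherwise set $i=1$. If the loop column $i$ is a candidate to leave the basis, let it leave; otherwise let leave any column corresponding to a woman-disliked (with respect to $D$) valid edge that is a candidate to leave the basis.
   Context: Instance: men $M=\{m_1,\dots,m_k\}$, women $W=\{w_1,\dots,w_k\}$; $v_i=m_i$, $v_{k+i}=w_i$ ($i\in[k]$), $n=2k$; all preferences strict and complete. Graph: $n$ loops $e_1,\dots,e_n$ ($e_i$ at $v_i$) and $k^2$ valid edges $(m,w)$; each agent prefers every valid edge containing it to its loop. Columns indexed by $[n+k^2]$: column $j\le n$ is loop $e_j$; for $i\in[k]$ columns $n+k(i-1)+1,\dots,n+ki$ are the edges $(m_i,w)$ in decreasing order of $m_i$'s preference. $A$: $a_{ij}=1$ iff $v_i\in e_j$, else $0$; $b=(1,\dots,1)^T$. $C=(c_{ij})$: if $v_i\in e_j$ and $e_j$ is the $\ell$-th best of the $k+1$ edges containing $v_i$ (loop last), $c_{ij}=k+1-\ell$; if $e_j$ is a valid edge not containing $v_i$, $c_{ij}\in\{k+1,\dots,k^2\}$, assigned in decreasing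 order from left to right; if $e_j$ is a loop with $j\neq i$, $c_{ij}\in\{k^2+1,\dots,k^2+2k-1\}$, assigned in decreasing order from left to right. Feasible basis: $n$ linearly independent columns $B$ of $A$ with $A_B^{-1}b\ge0$. Ordinal basis: $n$ columns $D$ such that, with utility vector $u_i=\min_{j\in D}c_{ij}$, every column $h$ has some $i$ with $u_i\ge c_{ih}$; for an ordinal basis, for each row $i$ there is a unique $j\in D$ with $c_{ij}=u_i$, and $e_j$ is then called $v_i$-disliked (w.r.t. $D$); an edge is man-disliked (woman-disliked) if it is $v$-disliked for a man (woman) $v$. Separator of $D$ (used when $u_1\in\{k+1,\dots,k^2\}$): the man $m_i$ where $i$ is the smallest index in $\{2,\dots,k\}$ with column $i$ (the loop of $m_i$) in $D$. A column $j_\ell\in B$ is a candidate to leave if $B\setminus\{j_\ell\}\cup\{j_t\}$ is a feasible basis. Scarf's algorithm: start with $B=\{1,\dots,n\}$, $D=\{j_0,2,\dots,n\}$, $j_0$ maximizing $c_{1j}$ over $j>n$. While $B\ne D$: with $\{j_t\}=D\setminus B$, a cardinal pivot replaces $B$ by $B\setminus\{j_\ell\}\cup\{j_t\}$ for a candidate $j_\ell$; if then $B\ne D$, an ordinal pivot replaces $D$ by $D\setminus\{j_\ell\}\cup\{j^*\}$, $j^*\notin D$ the unique column making it an ordinal basis. An iteration is one cardinal pivot followed by (if no termination) one ordinal pivot.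
   Formalization: As worded the rule may allow no column to leave (k=2, identical lists: after one iteration only the loop of w_1 is a candidate). Proved: every run obeying the literal rule has O(n^2) iterations; if woman-disliked loops may leave too, it always reaches B=D in O(n^2) iterations. *)

theory Defs
  imports "Jordan_Normal_Form.DL_Rank" "Jordan_Normal_Form.DL_Submatrix"
begin

text \<open>
  All indices start at 0, including rows and columns. For \<open>i < k\<close> the agent \<open>i\<close> is the man \<open>i\<close> and
  the agent \<open>k + i\<close> is the woman \<open>i\<close>. The entries of \<open>C\<close> are unaffected by this shift of indices.
\<close>

section \<open>Feasible and ordinal bases\<close>

definition feasible_basis :: "real mat \<Rightarrow> real vec \<Rightarrow> nat set \<Rightarrow> bool" where
  "feasible_basis A b B \<longleftrightarrow>
     B \<subseteq> {..<dim_col A} \<and> card B = dim_row A \<and>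
     inj_on (col A) B \<and>
     LinearCombinations.module.lin_indpt class_ring (module_vec TYPE(real) (dim_row A)) (col A ` B) \<and>
     (\<exists>X. inverts_mat (submatrix A UNIV B) X \<and> inverts_mat X (submatrix A UNIV B) \<and>
          0\<^sub>v (dim_row A) \<le> X *\<^sub>v b)"

definition candidate_to_leave :: "real mat \<Rightarrow> real vec \<Rightarrow> nat set \<Rightarrow> nat \<Rightarrow> nat \<Rightarrow> bool" where
  "candidate_to_leave A b B jt jl \<longleftrightarrow> jl \<in> B \<and> feasible_basis A b (B - {jl} \<union> {jt})"

definition utility :: "nat mat \<Rightarrow> nat set \<Rightarrow> nat \<Rightarrow> nat" where
  "utility C D i = Min ((\<lambda>j. C $$ (i, j)) ` D)"

definition ordinal_basis :: "nat mat \<Rightarrow> nat set \<Rightarrow> bool" where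
  "ordinal_basis C D \<longleftrightarrow>
     D \<subseteq> {..<dim_col C} \<and> card D = dim_row C \<and>
     (\<forall>h < dim_col C. \<exists>i < dim_row C. utility C D i \<ge> C $$ (i, h))"

definition disliked :: "nat mat \<Rightarrow> nat set \<Rightarrow> nat \<Rightarrow> nat \<Rightarrow> bool" where
  "disliked C D i j \<longleftrightarrow> j \<in> D \<and> C $$ (i, j) = utility C D i"

section \<open>Complete marriage instances\<close>

text \<open>\<open>MP m\<close> lists the women in decreasing order of preference of man \<open>m\<close>, and \<open>WP w\<close> the men in
  decreasing order of preference of woman \<open>w\<close>.\<close>

definition complete_marriage_instance ::
    "nat \<Rightarrow> (nat \<Rightarrow> nat list) \<Rightarrow> (nat \<Rightarrow> nat list) \<Rightarrow> bool" where
  "complete_marriage_instance k MP WP \<longleftrightarrow>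
     (\<forall>m<k. distinct (MP m) \<and> set (MP m) = {..<k}) \<and>
     (\<forall>w<k. distinct (WP w) \<and> set (WP w) = {..<k})"

datatype edge = Loop nat \<comment> \<open>agent\<close> | Valid nat nat \<comment> \<open>man, woman\<close>

fun edge_agents :: "nat \<Rightarrow> edge \<Rightarrow> nat set" where
  "edge_agents k (Loop v) = {v}"
| "edge_agents k (Valid m w) = {m, k + w}"

definition num_cols :: "nat \<Rightarrow> nat" where
  "num_cols k = 2 * k + k\<^sup>2"

definition valid_cols :: "nat \<Rightarrow> nat set" where
  "valid_cols k = {2 * k..<num_cols k}"

definition col_edge :: "nat \<Rightarrow> (nat \<Rightarrow> nat list) \<Rightarrow> nat \<Rightarrow> edge" where
  "col_edge k MP j =
     (if j < 2 * k then Loop j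
      else (let m = (j - 2 * k) div k; p = (j - 2 * k) mod k in Valid m (MP m ! p)))"

definition incident :: "nat \<Rightarrow> (nat \<Rightarrow> nat list) \<Rightarrow> nat \<Rightarrow> nat \<Rightarrow> bool" where
  "incident k MP v j \<longleftrightarrow> v \<in> edge_agents k (col_edge k MP j)"

text \<open>The number \<open>l\<close> such that the edge, assumed to contain \<open>v\<close>, is the \<open>l\<close>-th best of the \<open>k + 1\<close>
  edges containing \<open>v\<close>; here \<open>l\<close> is counted from 1, and the loop is the last of them.\<close>

fun edge_rank :: "nat \<Rightarrow> (nat \<Rightarrow> nat list) \<Rightarrow> (nat \<Rightarrow> nat list) \<Rightarrow> nat \<Rightarrow> edge \<Rightarrow> nat" where
  "edge_rank k MP WP v (Loop _) = k + 1"
| "edge_rank k MP WP v (Valid m w) =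
     (if v < k then length (takeWhile (\<lambda>x. x \<noteq> w) (MP m)) + 1
      else length (takeWhile (\<lambda>x. x \<noteq> m) (WP w)) + 1)"

definition A_mat :: "nat \<Rightarrow> (nat \<Rightarrow> nat list) \<Rightarrow> real mat" where
  "A_mat k MP = mat (2 * k) (num_cols k) (\<lambda>(i, j). if incident k MP i j then 1 else 0)"

definition b_vec :: "nat \<Rightarrow> real vec" where
  "b_vec k = vec (2 * k) (\<lambda>_. 1)"

text \<open>\<open>decreasing_from M S\<close> assigns the values \<open>M, M - 1, M - 2, \<dots>\<close> to the elements of \<open>S\<close> from left to
  right. Row \<open>i\<close> has \<open>k\<^sup>2 - k\<close> valid edges not containing the agent \<open>i\<close>, which therefore receive the
  values \<open>k\<^sup>2, \<dots>, k + 1\<close>, and \<open>2 * k - 1\<close> loops at other agents, which receive the values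
  \<open>k\<^sup>2 + 2 * k - 1, \<dots>, k\<^sup>2 + 1\<close>.\<close>

definition decreasing_from :: "nat \<Rightarrow> nat set \<Rightarrow> nat \<Rightarrow> nat" where
  "decreasing_from M S j = M - card {h \<in> S. h < j}"

definition C_mat :: "nat \<Rightarrow> (nat \<Rightarrow> nat list) \<Rightarrow> (nat \<Rightarrow> nat list) \<Rightarrow> nat mat" where
  "C_mat k MP WP = mat (2 * k) (num_cols k) (\<lambda>(i, j).
     if incident k MP i j then k + 1 - edge_rank k MP WP i (col_edge k MP j)
     else if j \<in> valid_cols k then decreasing_from (k\<^sup>2) {h \<in> valid_cols k. \<not> incident k MP i h} j
     else decreasing_from (k\<^sup>2 + 2 * k - 1) ({..<2 * k} - {i}) j)"

definition woman_disliked ::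
    "nat \<Rightarrow> (nat \<Rightarrow> nat list) \<Rightarrow> (nat \<Rightarrow> nat list) \<Rightarrow> nat set \<Rightarrow> nat \<Rightarrow> bool" where
  "woman_disliked k MP WP D j \<longleftrightarrow> (\<exists>v\<in>{k..<2 * k}. disliked (C_mat k MP WP) D v j)"

definition separator :: "nat \<Rightarrow> nat set \<Rightarrow> nat \<Rightarrow> bool" where
  "separator k D i \<longleftrightarrow> i \<in> {1..<k} \<inter> D \<and> (\<forall>i' \<in> {1..<k} \<inter> D. i \<le> i')"

section \<open>Scarf's algorithm with the pivoting rule\<close>

text \<open>
  \<open>leaves k MP WP W B D jl\<close>: the rule allows the column \<open>jl\<close> to leave \<open>B\<close>. The parameter \<open>W\<close>
  restricts the woman-disliked columns that may leave. The rule about woman-disliked valid edges is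
  the case \<open>W = valid_cols k\<close>. For \<open>W = UNIV\<close> the loop of a woman, when it is woman-disliked,
  may leave as well. This is sometimes the only choice: for \<open>k = 2\<close> and identity preference lists
  the first iteration leads to \<open>B = {0, 2, 3, 6}\<close>, \<open>D = {2, 3, 4, 6}\<close>, where the loop \<open>2\<close> is the
  only candidate to leave.
\<close>

definition leaves ::
    "nat \<Rightarrow> (nat \<Rightarrow> nat list) \<Rightarrow> (nat \<Rightarrow> nat list) \<Rightarrow> nat set \<Rightarrow> nat set \<Rightarrow> nat set \<Rightarrow> nat \<Rightarrow> bool" where
  "leaves k MP WP W B D jl \<longleftrightarrow>
     (\<exists>i jt. D - B = {jt} \<and>
        (if utility (C_mat k MP WP) D 0 \<in> {k + 1..k\<^sup>2} then separator k D i else i = 0) \<and>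
        (if candidate_to_leave (A_mat k MP) (b_vec k) B jt i then jl = i
         else jl \<in> W \<and> woman_disliked k MP WP D jl \<and>
              candidate_to_leave (A_mat k MP) (b_vec k) B jt jl))"

definition scarf_init :: "nat \<Rightarrow> (nat \<Rightarrow> nat list) \<Rightarrow> (nat \<Rightarrow> nat list) \<Rightarrow> nat set \<times> nat set" where
  "scarf_init k MP WP =
     ({..<2 * k},
      insert (arg_max (\<lambda>j. C_mat k MP WP $$ (0, j)) (\<lambda>j. j \<in> valid_cols k)) {1..<2 * k})"

text \<open>A state is a pair \<open>(B, D)\<close>. An iteration is possible only while \<open>B \<noteq> D\<close>, and it leaves \<open>D\<close>
  unchanged if its cardinal pivot achieves \<open>B' = D\<close>.\<close>

inductive scarf_iteration ::
    "nat \<Rightarrow> (nat \<Rightarrow> nat list) \<Rightarrow> (nat \<Rightarrow> nat list) \<Rightarrow> nat set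
      \<Rightarrow> nat set \<times> nat set \<Rightarrow> nat set \<times> nat set \<Rightarrow> bool"
  for k MP WP W where
  final:
    "scarf_iteration k MP WP W (B, D) (B', D)"
    if "B \<noteq> D" "leaves k MP WP W B D jl" "D - B = {jt}" "B' = B - {jl} \<union> {jt}" "B' = D"
| pivot:
    "scarf_iteration k MP WP W (B, D) (B', D - {jl} \<union> {j'})"
    if "B \<noteq> D" "leaves k MP WP W B D jl" "D - B = {jt}" "B' = B - {jl} \<union> {jt}" "B' \<noteq> D"
       "j' \<notin> D" "ordinal_basis (C_mat k MP WP) (D - {jl} \<union> {j'})"

end

theory Submission
  imports Defs
begin

text \<open>
  The ordinal pivots of a run have one direction. When the column disliked by row \<open>l\<close> leaves \<open>D\<close>, the
  utility of \<open>l\<close> rises, the utility of exactly one other row \<open>v\<close> drops, and \<open>v\<close> is the row that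
  dislikes the column which \<open>l\<close> comes to dislike. Every agent but the first man has an incident
  column in \<open>B \<inter> D\<close>, hence if \<open>l\<close> is a woman then \<open>v\<close> is a man. If the loop of the separator
  leaves, then \<open>v\<close> is the first man, because the first man dislikes the rightmost valid column of
  \<open>D\<close>, and the separator is the man of that column. So the women's utilities never fall, the first
  man's utility never rises, and their total change gives the bound \<open>2 * k\<^sup>2 + 1\<close>.

  The rule never gets stuck because, after changing the signs of the women's rows and columns, the
  matrix of disliked columns is \<open>1 - P\<close> with \<open>P\<close> nonnegative and column-substochastic. Therefore a
  man-disliked column, the loop of the separator excepted, has a nonpositive coefficient in the
  expression of a man-disliked entering column in terms of \<open>B\<close>, and the ratio test selects a column
  that the rule allows.
\<close>

section \<open>Feasible bases\<close>

lemma bij_betw_pick: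
  assumes "finite S"
  shows "bij_betw (pick S) {..<card S} S"
proof -
  have "inj_on (pick S) {..<card S}"
    by (rule linorder_inj_onI') (metis lessThan_iff nat_neq_iff pick_mono_le)
  moreover have "pick S ` {..<card S} \<subseteq> S"
    using pick_in_set_le by auto
  ultimately show ?thesis
    using assms by (metis bij_betw_def card_image card_lessThan card_subset_eq)
qed

lemma pick_surj:
  assumes "finite S" "j \<in> S"
  shows "\<exists>t<card S. j = pick S t"
proof -
  have "j \<in> pick S ` {..<card S}"
    using bij_betw_imp_surj_on[OF bij_betw_pick[OF assms(1)]] assms(2) by simp
  then show ?thesis by auto
qed

lemma submatrix_UNIV_carrier:
  assumes "B \<subseteq> {..<dim_col A}"
  shows "submatrix A UNIV B \<in> carrier_mat (dim_row A) (card B)"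
proof -
  have "{j. j < dim_col A \<and> j \<in> B} = B" using assms by auto
  then show ?thesis unfolding submatrix_def by (auto intro!: carrier_matI)
qed

lemma submatrix_UNIV_index:
  assumes "B \<subseteq> {..<dim_col A}" "i < dim_row A" "j < card B"
  shows "submatrix A UNIV B $$ (i, j) = A $$ (i, pick B j)"
proof -
  have "{j. j < dim_col A \<and> j \<in> B} = B" using assms by auto
  then show ?thesis using assms by (subst submatrix_index) (auto simp: pick_UNIV)
qed

lemma submatrix_UNIV_mult_vec:
  fixes A :: "real mat"
  assumes "B \<subseteq> {..<dim_col A}" "i < dim_row A"
  shows "(submatrix A UNIV B *\<^sub>v vec (card B) (\<lambda>j. z (pick B j))) $ i = (\<Sum>j\<in>B. A $$ (i, j) * z j)"
proof -
  have fin: "finite B" using assms(1) finite_subset by auto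
  note M = submatrix_UNIV_carrier[OF assms(1)]
  have "(submatrix A UNIV B *\<^sub>v vec (card B) (\<lambda>j. z (pick B j))) $ i
      = (\<Sum>j<card B. A $$ (i, pick B j) * z (pick B j))"
    using assms M
    by (auto simp: scalar_prod_def atLeast0LessThan submatrix_UNIV_index intro!: sum.cong)
  also have "\<dots> = (\<Sum>j\<in>B. A $$ (i, j) * z j)"
    using sum.reindex_bij_betw[OF bij_betw_pick[OF fin], of "\<lambda>j. A $$ (i, j) * z j"] by simp
  finally show ?thesis .
qed

lemma vec_as_pick:
  assumes "finite B" "v \<in> carrier_vec (card B)"
  obtains z where "v = vec (card B) (\<lambda>j. z (pick B j))"
proof
  let ?z = "\<lambda>j. v $ inv_into {..<card B} (pick B) j"
  show "v = vec (card B) (\<lambda>j. ?z (pick B j))"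
    using assms bij_betw_imp_inj_on[OF bij_betw_pick[OF assms(1)]] by (intro eq_vecI) auto
qed

lemma cols_submatrix_UNIV:
  assumes "B \<subseteq> {..<dim_col A}"
  shows "set (cols (submatrix A UNIV B)) = col A ` B"
proof -
  have fin: "finite B" using assms finite_subset by auto
  note M = submatrix_UNIV_carrier[OF assms]
  have "col (submatrix A UNIV B) j = col A (pick B j)" if "j < card B" for j
    using that M assms pick_in_set_le[OF that]
    by (intro eq_vecI) (auto simp: submatrix_UNIV_index)
  then have "set (cols (submatrix A UNIV B)) = (\<lambda>j. col A (pick B j)) ` {..<card B}"
    using M by (auto simp: cols_def)
  also have "\<dots> = col A ` B"
    using bij_betw_imp_surj_on[OF bij_betw_pick[OF fin]] by (metis image_image)
  finally show ?thesis .
qed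

lemma feasible_basis_span:
  assumes "feasible_basis A b B"
  obtains y where "\<And>i. i < dim_row A \<Longrightarrow> (\<Sum>j\<in>B. A $$ (i, j) * y j) = (f i :: real)"
proof -
  let ?M = "submatrix A UNIV B" and ?n = "dim_row A"
  have B: "B \<subseteq> {..<dim_col A}" "card B = ?n" and fin: "finite B"
    using assms finite_subset unfolding feasible_basis_def by auto
  note M = submatrix_UNIV_carrier[OF B(1), unfolded B(2)]
  obtain X where X: "?M * X = 1\<^sub>m ?n" "X * ?M = 1\<^sub>m (dim_row X)"
    using assms M unfolding feasible_basis_def inverts_mat_def by auto
  have Xc: "X \<in> carrier_mat ?n ?n"
    using X M by (metis carrier_matD(2) carrier_matI index_mult_mat(3) index_one_mat(3))
  obtain y where y: "X *\<^sub>v vec ?n f = vec (card B) (\<lambda>j. y (pick B j))"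
    using vec_as_pick[OF fin] Xc B(2) by (metis mult_mat_vec_carrier vec_carrier)
  have "?M *\<^sub>v (X *\<^sub>v vec ?n f) = vec ?n f"
    using X(1) M Xc by (subst assoc_mult_mat_vec[symmetric, where ?n\<^sub>1="?n" and ?n\<^sub>2="?n" and ?n\<^sub>3="?n"]) auto
  then have "(\<Sum>j\<in>B. A $$ (i, j) * y j) = f i" if "i < ?n" for i
    using submatrix_UNIV_mult_vec[OF B(1) that, of y] that unfolding y by simp
  then show ?thesis using that by blast
qed

text \<open>Frees everything that follows from inverses and from the numbering of columns by
  \<open>pick\<close>: a trivial kernel on \<open>B\<close> makes the square submatrix invertible,
  and the nonnegative solution must then be \<open>X *\<^sub>v b\<close>.\<close>

lemma feasible_basis_iff:
  fixes A :: "real mat"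
  assumes b: "dim_vec b = dim_row A"
  shows "feasible_basis A b B \<longleftrightarrow>
     B \<subseteq> {..<dim_col A} \<and> card B = dim_row A \<and>
     (\<forall>z. (\<forall>i<dim_row A. (\<Sum>j\<in>B. A $$ (i, j) * z j) = 0) \<longrightarrow> (\<forall>j\<in>B. z j = 0)) \<and>
     (\<exists>x. (\<forall>j\<in>B. 0 \<le> x j) \<and> (\<forall>i<dim_row A. (\<Sum>j\<in>B. A $$ (i, j) * x j) = b $ i))"
    (is "?L \<longleftrightarrow> ?R")
proof
  let ?M = "submatrix A UNIV B" and ?n = "dim_row A"
  assume L: ?L
  then have B: "B \<subseteq> {..<dim_col A}" "card B = ?n" and fin: "finite B"
    using finite_subset unfolding feasible_basis_def by auto
  note M = submatrix_UNIV_carrier[OF B(1), unfolded B(2)]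
  obtain X where X: "?M * X = 1\<^sub>m ?n" "X * ?M = 1\<^sub>m (dim_row X)" and pos: "0\<^sub>v ?n \<le> X *\<^sub>v b"
    using L M unfolding feasible_basis_def inverts_mat_def by auto
  have Xc: "X \<in> carrier_mat ?n ?n"
    using X M by (metis carrier_matD(2) carrier_matI index_mult_mat(3) index_one_mat(3))
  have bc: "b \<in> carrier_vec ?n" using b by (metis carrier_vec_dim_vec)
  obtain x where x: "X *\<^sub>v b = vec (card B) (\<lambda>j. x (pick B j))"
    using vec_as_pick[OF fin] Xc B(2) bc by (metis mult_mat_vec_carrier)
  have "?M *\<^sub>v (X *\<^sub>v b) = b"
    using X(1) M Xc bc by (subst assoc_mult_mat_vec[symmetric, where ?n\<^sub>1="?n" and ?n\<^sub>2="?n" and ?n\<^sub>3="?n"]) auto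
  then have x1: "(\<Sum>j\<in>B. A $$ (i, j) * x j) = b $ i" if "i < ?n" for i
    using submatrix_UNIV_mult_vec[OF B(1) that, of x] that unfolding x by simp
  have x2: "0 \<le> x j" if j: "j \<in> B" for j
  proof -
    obtain t where t: "t < ?n" "j = pick B t"
      using pick_surj[OF fin j] B(2) by auto
    show ?thesis using pos t B(2) unfolding x less_eq_vec_def by auto
  qed
  have "z j = 0" if z: "\<forall>i<?n. (\<Sum>j\<in>B. A $$ (i, j) * z j) = 0" and j: "j \<in> B" for z j
  proof -
    let ?v = "vec (card B) (\<lambda>j. z (pick B j))"
    have vc: "?v \<in> carrier_vec ?n" using B(2) by auto
    have "?M *\<^sub>v ?v = 0\<^sub>v ?n"
      using M z submatrix_UNIV_mult_vec[OF B(1), of _ z] by (intro eq_vecI) auto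
    then have "X *\<^sub>v (?M *\<^sub>v ?v) = 0\<^sub>v ?n" using Xc by (intro eq_vecI) (auto simp: scalar_prod_def)
    moreover have "X *\<^sub>v (?M *\<^sub>v ?v) = ?v"
      using X(2) M Xc vc by (subst assoc_mult_mat_vec[symmetric, where ?n\<^sub>1="?n" and ?n\<^sub>2="?n" and ?n\<^sub>3="?n"]) auto
    ultimately have v0: "?v = 0\<^sub>v ?n" by simp
    obtain t where t: "t < ?n" "j = pick B t"
      using pick_surj[OF fin j] B(2) by auto
    have "?v $ t = 0" using v0 t by simp
    then show ?thesis using t B(2) by simp
  qed
  then show ?R using B x1 x2 by blast
next
  let ?M = "submatrix A UNIV B" and ?n = "dim_row A"
  assume R: ?R
  then have B: "B \<subseteq> {..<dim_col A}" "card B = ?n" and fin: "finite B"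
    using finite_subset by auto
  note M = submatrix_UNIV_carrier[OF B(1), unfolded B(2)]
  obtain x where x: "\<forall>j\<in>B. 0 \<le> x j" "\<forall>i<?n. (\<Sum>j\<in>B. A $$ (i, j) * x j) = b $ i"
    using R by blast
  have indep: "\<forall>j\<in>B. z j = 0" if "\<forall>i<?n. (\<Sum>j\<in>B. A $$ (i, j) * z j) = 0" for z
    using R that by blast
  have det: "det ?M \<noteq> 0"
  proof
    assume "det ?M = 0"
    then obtain v where v: "v \<in> carrier_vec ?n" "v \<noteq> 0\<^sub>v ?n" "?M *\<^sub>v v = 0\<^sub>v ?n"
      using det_0_iff_vec_prod_zero_field[OF M] by auto
    obtain z where z: "v = vec (card B) (\<lambda>j. z (pick B j))"
      using vec_as_pick[OF fin] v(1) B(2) by metis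
    have "\<forall>i<?n. (\<Sum>j\<in>B. A $$ (i, j) * z j) = 0"
      using submatrix_UNIV_mult_vec[OF B(1), of _ z] v(3) unfolding z by simp
    then have "\<forall>j\<in>B. z j = 0" by (rule indep)
    then have "v = 0\<^sub>v ?n"
      using pick_in_set_le[of _ B] B(2) unfolding z by (intro eq_vecI) auto
    then show False using v(2) by simp
  qed
  obtain X where Xc: "X \<in> carrier_mat ?n ?n" and X: "X * ?M = 1\<^sub>m ?n" "?M * X = 1\<^sub>m ?n"
    using det_non_zero_imp_unit[OF M det, where b = "()"] unfolding Units_def ring_mat_def by auto
  have "X *\<^sub>v b = vec (card B) (\<lambda>j. x (pick B j))"
  proof -
    let ?v = "vec (card B) (\<lambda>j. x (pick B j))"
    have vc: "?v \<in> carrier_vec ?n" using B(2) by auto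
    have "?M *\<^sub>v ?v = b"
      using M x(2) b submatrix_UNIV_mult_vec[OF B(1), of _ x] by (intro eq_vecI) auto
    then have "X *\<^sub>v b = X *\<^sub>v (?M *\<^sub>v ?v)" by simp
    also have "\<dots> = ?v"
      using X(1) M Xc vc by (subst assoc_mult_mat_vec[symmetric, where ?n\<^sub>1="?n" and ?n\<^sub>2="?n" and ?n\<^sub>3="?n"]) auto
    finally show ?thesis .
  qed
  then have pos: "0\<^sub>v ?n \<le> X *\<^sub>v b"
    using x(1) B(2) pick_in_set_le[of _ B] unfolding less_eq_vec_def by auto
  have inj: "inj_on (col A) B"
  proof (rule inj_onI, rule ccontr)
    fix p q assume pq: "p \<in> B" "q \<in> B" "col A p = col A q" "p \<noteq> q"
    have eq: "A $$ (i, p) = A $$ (i, q)" if "i < ?n" for i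
      using pq B(1) that by (metis index_col lessThan_iff subsetD)
    define z :: "nat \<Rightarrow> real" where "z = (\<lambda>j. if j = p then 1 else if j = q then - 1 else 0)"
    have "(\<Sum>j\<in>B. A $$ (i, j) * z j) = 0" if "i < ?n" for i
    proof -
      have "(\<Sum>j\<in>B. A $$ (i, j) * z j) = (\<Sum>j\<in>{p, q}. A $$ (i, j) * z j)"
        using pq fin by (intro sum.mono_neutral_right) (auto simp: z_def)
      then show ?thesis using pq(4) eq[OF that] by (simp add: z_def)
    qed
    then have "z p = 0" using indep pq(1) by blast
    then show False by (simp add: z_def)
  qed
  interpret idom_vec ?n "TYPE(real)" .
  have "lin_indpt (set (cols ?M))"
    using lin_dep_cols_imp_det_0[OF M] det by blast
  then have "lin_indpt (col A ` B)" using cols_submatrix_UNIV[OF B(1)] by simp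
  then show ?L
    unfolding feasible_basis_def inverts_mat_def
    using B inj X Xc M pos by auto
qed

text \<open>The minimum ratio rule of the simplex method. Among the columns of \<open>B\<close> with
  a positive coefficient in the expansion \<open>y\<close> of column \<open>t\<close>, one with the
  least \<open>x j / y j\<close> leaves, so shifting the solution by that ratio along
  \<open>y\<close> keeps it nonnegative.\<close>

lemma ratio_test:
  fixes A :: "real mat"
  assumes b: "dim_vec b = dim_row A" and feas: "feasible_basis A b B"
    and t: "t < dim_col A" "t \<notin> B"
    and y: "\<And>i. i < dim_row A \<Longrightarrow> (\<Sum>j\<in>B. A $$ (i, j) * y j) = A $$ (i, t)"
    and ex: "\<exists>j\<in>B. y j > 0"
  shows "\<exists>j\<in>B. y j > 0 \<and> feasible_basis A b (B - {j} \<union> {t})"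
proof -
  let ?n = "dim_row A"
  have B: "B \<subseteq> {..<dim_col A}" "card B = ?n" and fin: "finite B"
    and indep: "\<And>z. \<forall>i<?n. (\<Sum>j\<in>B. A $$ (i, j) * z j) = 0 \<Longrightarrow> \<forall>j\<in>B. z j = 0"
    using feas[unfolded feasible_basis_iff[OF b]] finite_subset by auto
  obtain x where x: "\<forall>j\<in>B. 0 \<le> x j" "\<forall>i<?n. (\<Sum>j\<in>B. A $$ (i, j) * x j) = b $ i"
    using feas[unfolded feasible_basis_iff[OF b]] by blast
  have "finite {j\<in>B. y j > 0}" "{j\<in>B. y j > 0} \<noteq> {}" using fin ex by auto
  then obtain l where l: "l \<in> B" "y l > 0" and lmin: "\<And>j. j \<in> B \<Longrightarrow> y j > 0 \<Longrightarrow> x l / y l \<le> x j / y j"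
    using ex_min_if_finite[of "(\<lambda>j. x j / y j) ` {j\<in>B. y j > 0}"]
    by (force simp: not_less)
  have sumB': "(\<Sum>j\<in>B - {l} \<union> {t}. f j) = (\<Sum>j\<in>B. f j) - f l + f t" for f :: "nat \<Rightarrow> real"
    using t(2) fin l(1) by (simp add: sum_diff1)
  define \<theta> where "\<theta> = x l / y l"
  have \<theta>: "\<theta> \<ge> 0" using l x(1) by (simp add: \<theta>_def)
  define x' where "x' = (\<lambda>j. if j = t then \<theta> else x j - \<theta> * y j)"
  have x'l: "x l - \<theta> * y l = 0" using l by (simp add: \<theta>_def)
  have x'0: "0 \<le> x' j" if "j \<in> B - {l} \<union> {t}" for j
  proof (cases "j = t")
    case False
    then have j: "j \<in> B" using that by auto
    have "\<theta> * y j \<le> x j"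
    proof (cases "y j > 0")
      case True
      then show ?thesis using lmin[OF j True] by (simp add: \<theta>_def pos_le_divide_eq)
    next
      case False
      then have "\<theta> * y j \<le> 0" using \<theta> by (simp add: mult_nonneg_nonpos)
      then show ?thesis using x(1) j by force
    qed
    then show ?thesis using False by (simp add: x'_def)
  qed (use \<theta> in \<open>simp add: x'_def\<close>)
  have "(\<Sum>j\<in>B - {l} \<union> {t}. A $$ (i, j) * x' j) = b $ i" if i: "i < ?n" for i
  proof -
    have "(\<Sum>j\<in>B. A $$ (i, j) * x' j) = (\<Sum>j\<in>B. A $$ (i, j) * x j) - \<theta> * (\<Sum>j\<in>B. A $$ (i, j) * y j)"
      using t(2) unfolding sum_distrib_left sum_subtractf[symmetric]
      by (intro sum.cong) (auto simp: x'_def algebra_simps)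
    moreover have "x' l = 0" using l(1) t(2) x'l by (auto simp: x'_def)
    ultimately show ?thesis using x(2) y[OF i] i unfolding sumB' by (simp add: x'_def)
  qed
  moreover have "z j = 0" if z: "\<forall>i<?n. (\<Sum>j\<in>B - {l} \<union> {t}. A $$ (i, j) * z j) = 0"
    and j: "j \<in> B - {l} \<union> {t}" for z j
  proof -
    \<comment> \<open>Replacing column \<open>t\<close> by its expansion turns a relation on the new
      set into one on \<open>B\<close>. Its coefficient at \<open>l\<close> is
      \<open>z t * y l\<close> with \<open>y l > 0\<close>, which forces
      \<open>z t = 0\<close>.\<close>
    define z' where "z' = (\<lambda>j. (if j = l then 0 else z j) + z t * y j)"
    have "(\<Sum>j\<in>B. A $$ (i, j) * z' j) = 0" if i: "i < ?n" for i
    proof -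
      have "(\<Sum>j\<in>B. A $$ (i, j) * z' j)
          = (\<Sum>j\<in>B. A $$ (i, j) * (if j = l then 0 else z j)) + z t * (\<Sum>j\<in>B. A $$ (i, j) * y j)"
        unfolding sum_distrib_left sum.distrib[symmetric]
        by (intro sum.cong) (auto simp: z'_def algebra_simps)
      also have "(\<Sum>j\<in>B. A $$ (i, j) * (if j = l then 0 else z j)) = (\<Sum>j\<in>B. A $$ (i, j) * z j) - A $$ (i, l) * z l"
        using fin l(1) by (simp add: sum.remove)
      finally show ?thesis using z i y[OF i] unfolding sumB' by (simp add: mult.commute)
    qed
    then have z0: "\<forall>j\<in>B. z' j = 0" by (intro indep) auto
    then have "z t = 0" using l by (auto simp: z'_def)
    then show ?thesis using z0 j by (auto simp: z'_def)
  qed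
  moreover have "card (B - {l} \<union> {t}) = ?n"
    using card_Suc_Diff1[OF fin l(1)] fin B(2) t(2) by simp
  ultimately have "feasible_basis A b (B - {l} \<union> {t})"
    using B(1) t x'0 unfolding feasible_basis_iff[OF b] by blast
  then show ?thesis using l by blast
qed

section \<open>Ordinal bases\<close>

text \<open>The unique column disliked by row \<open>i\<close>, provided that the entries of the row are distinct.\<close>

definition worst :: "nat mat \<Rightarrow> nat set \<Rightarrow> nat \<Rightarrow> nat" where
  "worst C D i = (SOME j. disliked C D i j)"

lemma utility_le: "finite D \<Longrightarrow> j \<in> D \<Longrightarrow> utility C D i \<le> C $$ (i, j)"
  by (simp add: utility_def)

lemma utility_antimono:
  "finite D \<Longrightarrow> E \<subseteq> D \<Longrightarrow> E \<noteq> {} \<Longrightarrow> utility C D i \<le> utility C E i"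
  unfolding utility_def by (intro Min_antimono) auto

lemma utility_insert:
  "finite D \<Longrightarrow> D \<noteq> {} \<Longrightarrow> utility C (D \<union> {j}) i = min (C $$ (i, j)) (utility C D i)"
  by (simp add: utility_def)

lemma disliked_worst:
  assumes "finite D" "D \<noteq> {}"
  shows "disliked C D i (worst C D i)"
proof -
  have "utility C D i \<in> (\<lambda>j. C $$ (i, j)) ` D"
    unfolding utility_def using assms by (intro Min_in) auto
  then have "\<exists>j. disliked C D i j" by (auto simp: disliked_def)
  then show ?thesis unfolding worst_def by (rule someI_ex)
qed

locale distinct_row_entries =
  fixes C :: "nat mat"
  assumes inj_row: "i < dim_row C \<Longrightarrow> inj_on (\<lambda>j. C $$ (i, j)) {..<dim_col C}"
begin

lemma worst_eqI:
  assumes "D \<subseteq> {..<dim_col C}" "i < dim_row C" "j \<in> D" "C $$ (i, j) \<le> utility C D i"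
  shows "worst C D i = j"
proof -
  have fin: "finite D" using assms(1) finite_subset by auto
  have "disliked C D i (worst C D i)" using disliked_worst fin assms(3) by auto
  then have *: "worst C D i \<in> D" "C $$ (i, worst C D i) = C $$ (i, j)"
    using utility_le[OF fin assms(3), of C i] assms(4) by (auto simp: disliked_def)
  show ?thesis
    using inj_onD[OF inj_row[OF assms(2)] *(2)] *(1) assms(1,3) by blast
qed

context
  fixes D assumes D: "ordinal_basis C D"
begin

lemma ordinal_subset: "D \<subseteq> {..<dim_col C}"
  and ordinal_card: "card D = dim_row C"
  and ordinal_finite: "finite D"
  using D finite_subset by (auto simp: ordinal_basis_def)

lemma ordinal_dominated: "h < dim_col C \<Longrightarrow> \<exists>i<dim_row C. C $$ (i, h) \<le> utility C D i"
  using D by (auto simp: ordinal_basis_def)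

lemma worst_in: "i < dim_row C \<Longrightarrow> worst C D i \<in> D"
  and entry_worst: "i < dim_row C \<Longrightarrow> C $$ (i, worst C D i) = utility C D i"
proof -
  have "D \<noteq> {}" if "i < dim_row C" using that ordinal_card by auto
  then show "i < dim_row C \<Longrightarrow> worst C D i \<in> D" "i < dim_row C \<Longrightarrow> C $$ (i, worst C D i) = utility C D i"
    using disliked_worst[OF ordinal_finite, of C i] by (auto simp: disliked_def)
qed

lemma disliked_iff_worst: "i < dim_row C \<Longrightarrow> disliked C D i j \<longleftrightarrow> worst C D i = j"
  using worst_eqI[OF ordinal_subset] worst_in entry_worst by (auto simp: disliked_def)

text \<open>A column of \<open>D\<close> is itself dominated, and a row that dominates it must
  dislike it, so every column of \<open>D\<close> is disliked. As \<open>D\<close> has one column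
  per row, no column is disliked twice.\<close>

lemma bij_betw_worst: "bij_betw (worst C D) {..<dim_row C} D"
proof -
  have "worst C D ` {..<dim_row C} = D"
  proof (intro equalityI subsetI)
    fix j assume j: "j \<in> D"
    then obtain i where "i < dim_row C" "C $$ (i, j) \<le> utility C D i"
      using ordinal_dominated ordinal_subset by blast
    then show "j \<in> worst C D ` {..<dim_row C}" using worst_eqI[OF ordinal_subset] j by blast
  qed (use worst_in in auto)
  moreover from this have "inj_on (worst C D) {..<dim_row C}"
    using ordinal_card by (intro eq_card_imp_inj_on) auto
  ultimately show ?thesis by (simp add: bij_betw_def)
qed

lemma worst_inj: "i < dim_row C \<Longrightarrow> i' < dim_row C \<Longrightarrow> worst C D i = worst C D i' \<Longrightarrow> i = i'"
  using bij_betw_imp_inj_on[OF bij_betw_worst] by (auto dest: inj_onD)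

lemma worst_surj: "j \<in> D \<Longrightarrow> \<exists>i<dim_row C. worst C D i = j"
  using bij_betw_imp_surj_on[OF bij_betw_worst] by (metis imageE lessThan_iff)

end

text \<open>Let \<open>v\<close> be the row that dislikes \<open>j'\<close> afterwards. Rows other
  than \<open>v\<close> then dislike an old column and cannot fall; rows other than \<open>l\<close>
  still find their old disliked column and cannot rise. So only \<open>l\<close> and
  \<open>v\<close> change, and by bijectivity the old column of \<open>v\<close> is left to
  \<open>l\<close>.\<close>

lemma ordinal_exchange:
  assumes D: "ordinal_basis C D" and D': "ordinal_basis C (D - {worst C D l} \<union> {j'})" (is "ordinal_basis C ?D'")
    and l: "l < dim_row C" and j': "j' \<notin> D"
  shows "\<exists>v<dim_row C. v \<noteq> l \<and> worst C ?D' v = j' \<and> worst C ?D' l = worst C D v \<and>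
    utility C ?D' v < utility C D v \<and> utility C D l < utility C ?D' l \<and>
    (\<forall>i<dim_row C. i \<noteq> l \<longrightarrow> i \<noteq> v \<longrightarrow>
      utility C ?D' i = utility C D i \<and> worst C ?D' i = worst C D i)"
proof -
  let ?n = "dim_row C" and ?u = "utility C D" and ?u' = "utility C ?D'"
  obtain v where v: "v < ?n" "worst C ?D' v = j'" using worst_surj[OF D'] by blast
  have old: "?u i \<le> ?u' i" "worst C ?D' i \<in> D - {worst C D l}" if "i < ?n" "i \<noteq> v" for i
  proof -
    have "worst C ?D' i \<noteq> j'" using worst_inj[OF D' that(1) v(1)] v(2) that(2) by auto
    then show *: "worst C ?D' i \<in> D - {worst C D l}" using worst_in[OF D' that(1)] by auto
    then show "?u i \<le> ?u' i"
      using utility_le[OF ordinal_finite[OF D], of "worst C ?D' i" C i] entry_worst[OF D' that(1)] by auto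
  qed
  have new: "?u' i \<le> ?u i" if "i < ?n" "i \<noteq> l" for i
  proof -
    have "worst C D i \<noteq> worst C D l" using worst_inj[OF D that(1) l] that(2) by auto
    then have "worst C D i \<in> ?D'" using worst_in[OF D that(1)] by auto
    then show ?thesis
      using utility_le[OF ordinal_finite[OF D'], of "worst C D i" C i] entry_worst[OF D that(1)] by auto
  qed
  have same: "?u' i = ?u i" if "i < ?n" "i \<noteq> l" "i \<noteq> v" for i
    using old(1) new that by (simp add: le_antisym)
  have j'col: "j' < dim_col C" using ordinal_subset[OF D'] by auto
  have lcol: "worst C D l < dim_col C" using ordinal_subset[OF D] worst_in[OF D l] by auto
  have not_l: "v \<noteq> l"
  proof
    assume vl: "v = l"
    \<comment> \<open>With \<open>v = l\<close> no other row would change, so \<open>j'\<close>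
      would be dominated in \<open>D\<close>, and the removed column in \<open>?D'\<close>, by row
      \<open>l\<close> alone. The two entries in row \<open>l\<close> would coincide.\<close>
    obtain p where p: "p < ?n" "C $$ (p, j') \<le> ?u p" using ordinal_dominated[OF D j'col] by blast
    obtain q where q: "q < ?n" "C $$ (q, worst C D l) \<le> ?u' q" using ordinal_dominated[OF D' lcol] by blast
    have "p = l"
    proof (rule ccontr)
      assume "p \<noteq> l"
      then have "C $$ (p, j') \<le> ?u' p" using same[OF p(1)] p(2) vl by simp
      then have "worst C ?D' p = j'" using worst_eqI[OF ordinal_subset[OF D'] p(1)] by auto
      then show False using worst_inj[OF D' p(1) v(1)] v(2) vl \<open>p \<noteq> l\<close> by simp
    qed
    moreover have "q = l"
    proof (rule ccontr)
      assume "q \<noteq> l"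
      then have "C $$ (q, worst C D l) \<le> ?u q" using same[OF q(1)] q(2) vl by simp
      then have "worst C D q = worst C D l" using worst_eqI[OF ordinal_subset[OF D] q(1)] worst_in[OF D l] by auto
      then show False using worst_inj[OF D q(1) l] \<open>q \<noteq> l\<close> by simp
    qed
    ultimately have "C $$ (l, j') = C $$ (l, worst C D l)"
      using p q entry_worst[OF D l] entry_worst[OF D' l] v(2) vl by auto
    then have "j' = worst C D l" using inj_onD[OF inj_row[OF l]] j'col lcol by auto
    then show False using j' worst_in[OF D l] by auto
  qed
  have same_worst: "worst C ?D' i = worst C D i" if i: "i < ?n" "i \<noteq> l" "i \<noteq> v" for i
  proof (rule worst_eqI[OF ordinal_subset[OF D'] i(1)])
    show "worst C D i \<in> ?D'" using worst_in[OF D i(1)] worst_inj[OF D i(1) l] i(2) by auto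
    show "C $$ (i, worst C D i) \<le> ?u' i" using entry_worst[OF D i(1)] same[OF i] by simp
  qed
  have "worst C ?D' l = worst C D v"
  proof -
    have "worst C D v \<in> ?D'" using worst_in[OF D v(1)] worst_inj[OF D v(1) l] not_l by auto
    then obtain i where i: "i < ?n" "worst C ?D' i = worst C D v" using worst_surj[OF D'] by blast
    have "i \<noteq> v" using i v(2) j' worst_in[OF D v(1)] by metis
    then have "i = l" using same_worst[OF i(1)] i worst_inj[OF D i(1) v(1)] by metis
    then show ?thesis using i by simp
  qed
  moreover have "?u' v < ?u v"
  proof -
    have "?u' v \<noteq> ?u v"
    proof
      assume "?u' v = ?u v"
      then have "C $$ (v, j') = C $$ (v, worst C D v)"
        using entry_worst[OF D' v(1)] entry_worst[OF D v(1)] v(2) by simp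
      then have "j' = worst C D v"
        using inj_onD[OF inj_row[OF v(1)]] j'col worst_in[OF D v(1)] ordinal_subset[OF D] by blast
      then show False using j' worst_in[OF D v(1)] by simp
    qed
    then show ?thesis using new[OF v(1) not_l] by simp
  qed
  moreover have "?u l < ?u' l"
  proof -
    have "?u' l \<noteq> ?u l"
    proof
      assume "?u' l = ?u l"
      then have "worst C D l = worst C ?D' l"
        using worst_eqI[OF ordinal_subset[OF D] l] old(2)[OF l] not_l entry_worst[OF D' l] by auto
      then show False using old(2)[OF l] not_l by auto
    qed
    then show ?thesis using old(1)[OF l] not_l by simp
  qed
  ultimately show ?thesis using v not_l same same_worst by blast
qed

text \<open>If removing column \<open>worst C D l\<close> makes row \<open>l\<close> dislike the column disliked by row \<open>v\<close>, the
  entering column is the one that is best for \<open>v\<close> among those not dominated by the other rows.\<close>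

lemma ordinal_pivot_exists:
  assumes D: "ordinal_basis C D" and l: "l < dim_row C" and n: "dim_row C \<ge> 2"
    and free: "\<And>v. v < dim_row C \<Longrightarrow>
      \<exists>h<dim_col C. \<forall>i<dim_row C. i \<noteq> v \<longrightarrow> utility C (D - {worst C D l}) i < C $$ (i, h)"
  shows "\<exists>j'. j' \<notin> D \<and> ordinal_basis C (D - {worst C D l} \<union> {j'})"
proof -
  let ?n = "dim_row C" and ?E = "D - {worst C D l}"
  have finD: "finite D" by (rule ordinal_finite[OF D])
  have cE: "card ?E = ?n - 1" using ordinal_card[OF D] worst_in[OF D l] finD by simp
  have E0: "?E \<noteq> {}" using cE n by (metis card.empty diff_is_0_eq not_less_eq_eq numeral_2_eq_2 One_nat_def)
  have finE: "finite ?E" using finD by simp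
  have mono: "utility C D i \<le> utility C ?E i" for i using utility_antimono[OF finD _ E0] by auto
  have r: "disliked C ?E l (worst C ?E l)" by (rule disliked_worst[OF finE E0])
  then have "worst C ?E l \<in> D" by (simp add: disliked_def)
  then obtain v where v: "v < ?n" "worst C D v = worst C ?E l" using worst_surj[OF D] by blast
  have vl: "v \<noteq> l" using r v(2) by (auto simp: disliked_def)
  define S where "S = {h. h < dim_col C \<and> (\<forall>i<?n. i \<noteq> v \<longrightarrow> utility C ?E i < C $$ (i, h))}"
  have S: "finite S" "S \<noteq> {}" using free[OF v(1)] by (auto simp: S_def)
  then have "Max ((\<lambda>h. C $$ (v, h)) ` S) \<in> (\<lambda>h. C $$ (v, h)) ` S" by (intro Max_in) auto
  then obtain j' where j': "j' \<in> S" "C $$ (v, j') = Max ((\<lambda>h. C $$ (v, h)) ` S)" by auto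
  have j'max: "C $$ (v, h) \<le> C $$ (v, j')" if "h \<in> S" for h
    unfolding j'(2) using S(1) that by (intro Max_ge) auto
  have notin: "j' \<notin> D"
  proof
    assume "j' \<in> D"
    then obtain i where i: "i < ?n" "worst C D i = j'" using worst_surj[OF D] by blast
    show False
    proof (cases "i = v")
      case True
      then have "C $$ (l, j') = utility C ?E l" using r v(2) i(2) by (simp add: disliked_def)
      then show False using j'(1) l vl by (auto simp: S_def)
    next
      case False
      then have "utility C ?E i < C $$ (i, j')" using j'(1) i(1) by (auto simp: S_def)
      then show False using entry_worst[OF D i(1)] i(2) mono[of i] by simp
    qed
  qed
  have "\<exists>i<?n. C $$ (i, h) \<le> utility C (?E \<union> {j'}) i" if h: "h < dim_col C" for h
  proof (cases "h \<in> S")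
    case False
    then obtain i where i: "i < ?n" "i \<noteq> v" "C $$ (i, h) \<le> utility C ?E i"
      using h by (auto simp: S_def not_less)
    have "utility C ?E i < C $$ (i, j')" using j'(1) i by (auto simp: S_def)
    then show ?thesis using i unfolding utility_insert[OF finE E0] by auto
  next
    case True
    obtain i where i: "i < ?n" "C $$ (i, h) \<le> utility C D i" using ordinal_dominated[OF D h] by blast
    have "i = v" using True i mono[of i] by (force simp: S_def)
    then show ?thesis
      using i j'max[OF True] mono[of v] unfolding utility_insert[OF finE E0] by (intro exI[of _ v]) auto
  qed
  moreover have "card (?E \<union> {j'}) = ?n" using notin cE n finE by simp
  moreover have "?E \<union> {j'} \<subseteq> {..<dim_col C}" using ordinal_subset[OF D] j'(1) by (auto simp: S_def)
  ultimately have "ordinal_basis C (?E \<union> {j'})" unfolding ordinal_basis_def by blast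
  then show ?thesis using notin by blast
qed

end

section \<open>The entries of the ordinal matrix\<close>

lemma length_takeWhile_index:
  assumes "distinct xs" "p < length xs"
  shows "length (takeWhile (\<lambda>x. x \<noteq> xs ! p) xs) = p"
proof -
  have "takeWhile (\<lambda>x. x \<noteq> xs ! p) xs = take p xs"
    using assms by (intro takeWhile_eq_take_P_nth) (auto simp: nth_eq_iff_index_eq)
  then show ?thesis using assms(2) by simp
qed

lemma length_takeWhile_less:
  assumes "a \<in> set xs"
  shows "length (takeWhile (\<lambda>x. x \<noteq> a) xs) < length xs"
  using assms by (induction xs) auto

lemma length_takeWhile_inj:
  assumes "a \<in> set xs" "b \<in> set xs"
    "length (takeWhile (\<lambda>x. x \<noteq> a) xs) = length (takeWhile (\<lambda>x. x \<noteq> b) xs)"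
  shows "a = b"
  using assms by (induction xs) (auto split: if_splits)

text \<open>The bound \<open>card S \<le> M\<close> keeps the natural subtraction from stopping at
  0, where strictness would be lost.\<close>

lemma decreasing_from_less:
  assumes "finite S" "j \<in> S" "j < j'" "card S \<le> M"
  shows "decreasing_from M S j' < decreasing_from M S j"
proof -
  have "card {h \<in> S. h < j} < card {h \<in> S. h < j'}"
    using assms by (intro psubset_card_mono) auto
  moreover have "card {h \<in> S. h < j} < card S"
    using assms by (intro psubset_card_mono) auto
  ultimately show ?thesis using assms(4) by (simp add: decreasing_from_def)
qed

lemma decreasing_from_bounds:
  assumes "finite S" "j \<in> S"
  shows "M + 1 - card S \<le> decreasing_from M S j" "decreasing_from M S j \<le> M"
proof -
  have "card {h \<in> S. h < j} < card S"
    using assms by (intro psubset_card_mono) auto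
  then show "M + 1 - card S \<le> decreasing_from M S j" by (simp add: decreasing_from_def)
qed (simp add: decreasing_from_def)

locale marriage =
  fixes k :: nat and MP WP :: "nat \<Rightarrow> nat list"
  assumes k: "k \<ge> 1" and inst: "complete_marriage_instance k MP WP"
begin

abbreviation "A \<equiv> A_mat k MP"
abbreviation "b \<equiv> b_vec k"
abbreviation "C \<equiv> C_mat k MP WP"
abbreviation "inc \<equiv> incident k MP"
abbreviation "u \<equiv> utility C"

section \<open>Valid columns as pairs of a man and a woman\<close>

definition man :: "nat \<Rightarrow> nat" where "man j = (j - 2 * k) div k"
definition woman :: "nat \<Rightarrow> nat" where "woman j = MP (man j) ! ((j - 2 * k) mod k)"

lemma dims [simp]: "dim_row A = 2 * k" "dim_col A = num_cols k" "dim_row C = 2 * k"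
  "dim_col C = num_cols k" "dim_vec b = 2 * k"
  by (simp_all add: A_mat_def C_mat_def b_vec_def)

lemma MP: "m < k \<Longrightarrow> distinct (MP m)" "m < k \<Longrightarrow> set (MP m) = {..<k}" "m < k \<Longrightarrow> length (MP m) = k"
  and WP: "w < k \<Longrightarrow> distinct (WP w)" "w < k \<Longrightarrow> set (WP w) = {..<k}" "w < k \<Longrightarrow> length (WP w) = k"
  using inst distinct_card[of "MP m"] distinct_card[of "WP w"]
  by (auto simp: complete_marriage_instance_def)

lemma valid_iff: "j \<in> valid_cols k \<longleftrightarrow> 2 * k \<le> j \<and> j < num_cols k"
  by (auto simp: valid_cols_def)

lemma loop_less_num_cols: "v < 2 * k \<Longrightarrow> v < num_cols k"
  by (simp add: num_cols_def)

lemma col_cases: "j < num_cols k \<Longrightarrow> j < 2 * k \<or> j \<in> valid_cols k"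
  by (auto simp: valid_iff)

lemma man_less: "j \<in> valid_cols k \<Longrightarrow> man j < k"
  using k by (auto simp: valid_iff man_def num_cols_def div_less_iff_less_mult power2_eq_square)

lemma woman_less: "j \<in> valid_cols k \<Longrightarrow> woman j < k"
proof -
  assume j: "j \<in> valid_cols k"
  have "(j - 2 * k) mod k < length (MP (man j))" using MP(3)[OF man_less[OF j]] k by simp
  then have "woman j \<in> set (MP (man j))" unfolding woman_def by (rule nth_mem)
  then show ?thesis using MP(2)[OF man_less[OF j]] by simp
qed

text \<open>The blocks of valid columns follow the order of the men, so the position of a column
  locates its man. This is what ties the rightmost valid column to the separator.\<close>

lemma man_mono: "j \<le> j' \<Longrightarrow> man j \<le> man j'"
  unfolding man_def by (intro div_le_mono) auto

lemma inc_loop: "j < 2 * k \<Longrightarrow> inc v j \<longleftrightarrow> v = j"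
  by (simp add: incident_def col_edge_def)

lemma inc_valid: "j \<in> valid_cols k \<Longrightarrow> inc v j \<longleftrightarrow> v = man j \<or> v = k + woman j"
  by (auto simp: incident_def col_edge_def valid_iff man_def woman_def Let_def)

lemma inc_man: "j \<in> valid_cols k \<Longrightarrow> p < k \<Longrightarrow> inc p j \<longleftrightarrow> p = man j"
  by (auto simp: inc_valid)

lemma inc_woman: "j \<in> valid_cols k \<Longrightarrow> inc (k + w) j \<longleftrightarrow> w = woman j"
  using man_less[of j] by (auto simp: inc_valid)

lemma valid_col_eqI:
  assumes "j \<in> valid_cols k" "j' \<in> valid_cols k" "man j = man j'" "woman j = woman j'"
  shows "j = j'"
proof -
  have "(j - 2 * k) mod k = (j' - 2 * k) mod k"
    using nth_eq_iff_index_eq[OF MP(1)[OF man_less[OF assms(1)]], of "(j - 2 * k) mod k" "(j' - 2 * k) mod k"]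
      assms(3,4) MP(3)[OF man_less[OF assms(1)]] k unfolding woman_def by simp
  then have "(j - 2 * k) div k * k + (j - 2 * k) mod k = (j' - 2 * k) div k * k + (j' - 2 * k) mod k"
    using assms(3) unfolding man_def by simp
  then have "j - 2 * k = j' - 2 * k" by simp
  then show ?thesis using assms(1,2) unfolding valid_iff by linarith
qed

lemma valid_col_exists:
  assumes "m < k" "w < k"
  obtains j where "j \<in> valid_cols k" "man j = m" "woman j = w"
proof -
  obtain p where p: "p < k" "MP m ! p = w" using MP(2,3)[OF assms(1)] assms(2) by (metis in_set_conv_nth lessThan_iff)
  let ?j = "2 * k + (m * k + p)"
  have "m * k + p < k * k"
  proof -
    have "m * k + p < (m + 1) * k" using p(1) by simp
    also have "\<dots> \<le> k * k" using assms(1) by (intro mult_le_mono1) simp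
    finally show ?thesis .
  qed
  then have "?j \<in> valid_cols k" by (simp add: valid_iff num_cols_def power2_eq_square)
  moreover have "man ?j = m" using p(1) by (simp add: man_def)
  moreover from this have "woman ?j = w" using p by (simp add: woman_def)
  ultimately show ?thesis using that by blast
qed

lemma card_valid_cols: "card (valid_cols k) = k * k"
  by (simp add: valid_cols_def num_cols_def power2_eq_square)

lemma card_incident_valid:
  assumes "v < 2 * k"
  shows "card {h \<in> valid_cols k. inc v h} = k"
proof (cases "v < k")
  case True
  have "bij_betw woman {h \<in> valid_cols k. inc v h} {..<k}"
  proof (rule bij_betw_imageI)
    show "inj_on woman {h \<in> valid_cols k. inc v h}"
      using True by (auto simp: inj_on_def inc_man intro: valid_col_eqI)
    show "woman ` {h \<in> valid_cols k. inc v h} = {..<k}"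
    proof (intro equalityI subsetI)
      fix w assume "w \<in> {..<k}"
      then obtain j where "j \<in> valid_cols k" "man j = v" "woman j = w" using valid_col_exists True by auto
      then show "w \<in> woman ` {h \<in> valid_cols k. inc v h}" using True by (auto simp: inc_man)
    qed (auto simp: woman_less)
  qed
  then show ?thesis by (simp add: bij_betw_same_card)
next
  case False
  define w where "w = v - k"
  have v: "v = k + w" "w < k" using False assms by (auto simp: w_def)
  have "bij_betw man {h \<in> valid_cols k. inc v h} {..<k}"
  proof (rule bij_betw_imageI)
    show "inj_on man {h \<in> valid_cols k. inc v h}"
      unfolding v by (auto simp: inj_on_def inc_woman intro: valid_col_eqI)
    show "man ` {h \<in> valid_cols k. inc v h} = {..<k}"
    proof (intro equalityI subsetI)
      fix m assume "m \<in> {..<k}"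
      then obtain j where "j \<in> valid_cols k" "man j = m" "woman j = w" using valid_col_exists v by auto
      then show "m \<in> man ` {h \<in> valid_cols k. inc v h}" using v by (auto simp: inc_woman)
    qed (auto simp: man_less)
  qed
  then show ?thesis by (simp add: bij_betw_same_card)
qed

lemma card_not_incident_valid:
  assumes "v < 2 * k"
  shows "card {h \<in> valid_cols k. \<not> inc v h} = k * k - k"
proof -
  have "{h \<in> valid_cols k. \<not> inc v h} = valid_cols k - {h \<in> valid_cols k. inc v h}" by auto
  moreover have "card \<dots> = card (valid_cols k) - card {h \<in> valid_cols k. inc v h}"
    by (intro card_Diff_subset) (auto simp: valid_cols_def)
  ultimately show ?thesis using card_incident_valid[OF assms] card_valid_cols by simp
qed

section \<open>Values, ranges and order of the entries in one row of the ordinal matrix\<close>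

lemma C_own_loop: "v < 2 * k \<Longrightarrow> C $$ (v, v) = 0"
  by (simp add: C_mat_def inc_loop loop_less_num_cols col_edge_def)

lemma C_other_loop:
  assumes "v < 2 * k" "j < 2 * k" "j \<noteq> v"
  shows "C $$ (v, j) = decreasing_from (k\<^sup>2 + 2 * k - 1) ({..<2 * k} - {v}) j"
  using assms by (simp add: C_mat_def inc_loop loop_less_num_cols valid_iff)

lemma C_other_valid:
  assumes "v < 2 * k" "j \<in> valid_cols k" "\<not> inc v j"
  shows "C $$ (v, j) = decreasing_from (k\<^sup>2) {h \<in> valid_cols k. \<not> inc v h} j"
  using assms by (simp add: C_mat_def) (simp add: valid_iff)

lemma C_own_valid_man:
  assumes "j \<in> valid_cols k"
  shows "C $$ (man j, j) = k - (j - 2 * k) mod k"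
proof -
  have "length (takeWhile (\<lambda>x. x \<noteq> woman j) (MP (man j))) = (j - 2 * k) mod k"
    using MP[OF man_less[OF assms]] k unfolding woman_def by (intro length_takeWhile_index) auto
  then show ?thesis
    using assms man_less[OF assms]
    by (simp add: C_mat_def inc_valid valid_iff col_edge_def Let_def flip: man_def woman_def)
qed

lemma C_own_valid_woman:
  assumes "j \<in> valid_cols k"
  shows "C $$ (k + woman j, j) = k - length (takeWhile (\<lambda>x. x \<noteq> man j) (WP (woman j)))"
  using assms man_less[OF assms] woman_less[OF assms]
  by (simp add: C_mat_def inc_valid valid_iff col_edge_def Let_def flip: man_def)
     (simp add: woman_def flip: man_def)

lemma C_own_valid_bounds:
  assumes "j \<in> valid_cols k" "inc v j"
  shows "1 \<le> C $$ (v, j)" "C $$ (v, j) \<le> k"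
proof -
  have "1 \<le> C $$ (v, j) \<and> C $$ (v, j) \<le> k"
  proof (cases "v = man j")
    case True
    have "(j - 2 * k) mod k < k" using k by simp
    then show ?thesis using True C_own_valid_man[OF assms(1)] by simp
  next
    case False
    then have v: "v = k + woman j" using assms by (simp add: inc_valid)
    have "length (takeWhile (\<lambda>x. x \<noteq> man j) (WP (woman j))) < k"
      using length_takeWhile_less[of "man j" "WP (woman j)"] WP[OF woman_less[OF assms(1)]] man_less[OF assms(1)]
      by simp
    then show ?thesis unfolding v using C_own_valid_woman[OF assms(1)] by simp
  qed
  then show "1 \<le> C $$ (v, j)" "C $$ (v, j) \<le> k" by auto
qed

lemma C_other_valid_bounds:
  assumes "v < 2 * k" "j \<in> valid_cols k" "\<not> inc v j"
  shows "k < C $$ (v, j)" "C $$ (v, j) \<le> k\<^sup>2"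
proof -
  let ?S = "{h \<in> valid_cols k. \<not> inc v h}"
  have "finite ?S" "j \<in> ?S" using assms by (auto simp: valid_cols_def)
  note bounds = decreasing_from_bounds[OF this, of "k\<^sup>2"]
  have "k \<le> k * k" using k by simp
  then show "k < C $$ (v, j)" "C $$ (v, j) \<le> k\<^sup>2"
    using bounds card_not_incident_valid[OF assms(1)] C_other_valid[OF assms]
    by (auto simp: power2_eq_square)
qed

lemma C_other_loop_gt:
  assumes "v < 2 * k" "j < 2 * k" "j \<noteq> v"
  shows "k\<^sup>2 < C $$ (v, j)"
proof -
  let ?S = "{..<2 * k} - {v}"
  have "finite ?S" "j \<in> ?S" "card ?S = 2 * k - 1" using assms by auto
  then show ?thesis
    using decreasing_from_bounds(1)[of ?S j "k\<^sup>2 + 2 * k - 1"] C_other_loop[OF assms] k by simp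
qed

lemma C_other_valid_less:
  assumes "v < 2 * k" "j \<in> valid_cols k" "\<not> inc v j" "j' \<in> valid_cols k" "\<not> inc v j'" "j < j'"
  shows "C $$ (v, j') < C $$ (v, j)"
proof -
  let ?S = "{h \<in> valid_cols k. \<not> inc v h}"
  have "finite ?S" by (simp add: valid_cols_def)
  moreover have "j \<in> ?S" using assms by simp
  moreover have "card ?S \<le> k\<^sup>2"
    unfolding card_not_incident_valid[OF assms(1)] by (simp add: power2_eq_square)
  ultimately show ?thesis
    unfolding C_other_valid[OF assms(1-3)] C_other_valid[OF assms(1,4,5)]
    using decreasing_from_less assms(6) by blast
qed

lemma C_own_man_less:
  assumes "j \<in> valid_cols k" "j' \<in> valid_cols k" "man j = man j'" "j < j'"
  shows "C $$ (man j, j') < C $$ (man j, j)"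
proof -
  have "(j - 2 * k) mod k < (j' - 2 * k) mod k"
  proof -
    have "j - 2 * k < j' - 2 * k" using assms by (simp add: valid_iff)
    moreover have "man j * k + (j - 2 * k) mod k = j - 2 * k" by (simp add: man_def)
    moreover have "man j * k + (j' - 2 * k) mod k = j' - 2 * k" unfolding assms(3) by (simp add: man_def)
    ultimately show ?thesis by linarith
  qed
  moreover have "(j' - 2 * k) mod k < k" using k by simp
  ultimately show ?thesis
    using C_own_valid_man[OF assms(1)] C_own_valid_man[OF assms(2)] assms(3) by (simp add: diff_less_mono2)
qed

text \<open>The own loop (0), the own valid edges (1 to \<open>k\<close>), the other valid columns
  (\<open>k + 1\<close> to \<open>k\<^sup>2\<close>) and the other loops (beyond) occupy disjoint
  ranges. Inside a range the entries decrease from left to right, except for a woman's own edges,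
  where distinct men have distinct positions on her list.\<close>

lemma inj_C_row:
  assumes v: "v < 2 * k"
  shows "inj_on (\<lambda>j. C $$ (v, j)) {..<num_cols k}"
proof -
  have neq: "C $$ (v, j) \<noteq> C $$ (v, j')" if "j < j'" "j' < num_cols k" for j j'
  proof -
    have j: "j < num_cols k" using that by simp
    show ?thesis
    proof (cases "j' < 2 * k")
      case True
      show ?thesis
      proof (cases "j = v \<or> j' = v")
        case True
        then show ?thesis
          using that \<open>j' < 2 * k\<close> v C_own_loop[OF v] C_other_loop_gt[OF v, of j] C_other_loop_gt[OF v, of j'] by auto
      next
        case False
        then have "C $$ (v, j') < C $$ (v, j)"
          using decreasing_from_less[of "{..<2 * k} - {v}" j j' "k\<^sup>2 + 2 * k - 1"] that True v
          by (simp add: C_other_loop)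
        then show ?thesis by simp
      qed
    next
      case False
      then have j': "j' \<in> valid_cols k" using that by (simp add: valid_iff)
      show ?thesis
      proof (cases "j < 2 * k")
        case True
        have "0 < C $$ (v, j')" "C $$ (v, j') \<le> k\<^sup>2"
          using C_own_valid_bounds[OF j', of v] C_other_valid_bounds[OF v j'] self_le_power[of k 2] k
          by (cases "inc v j'"; linarith)+
        then show ?thesis
          using C_own_loop[OF v] C_other_loop_gt[OF v True] by (cases "j = v") auto
      next
        case False
        then have jv: "j \<in> valid_cols k" using j by (simp add: valid_iff)
        consider "inc v j" "inc v j'" "v < k" | "inc v j" "inc v j'" "v \<ge> k" | "inc v j" "\<not> inc v j'"
          | "\<not> inc v j" "inc v j'" | "\<not> inc v j" "\<not> inc v j'" by force
        then show ?thesis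
        proof cases
          case 1
          then show ?thesis using C_own_man_less[OF jv j' _ that(1)] jv j' by (auto simp: inc_man)
        next
          case 2
          then have w: "v = k + woman j" "woman j' = woman j"
            using jv j' man_less[OF jv] man_less[OF j'] by (auto simp: inc_valid)
          have "man j \<noteq> man j'" using valid_col_eqI[OF jv j'] w that(1) by auto
          moreover have m: "man j \<in> set (WP (woman j))" "man j' \<in> set (WP (woman j))"
            using WP(2)[OF woman_less[OF jv]] man_less[OF jv] man_less[OF j'] by auto
          ultimately have "length (takeWhile (\<lambda>x. x \<noteq> man j) (WP (woman j)))
              \<noteq> length (takeWhile (\<lambda>x. x \<noteq> man j') (WP (woman j)))"
            using length_takeWhile_inj[OF m] by auto
          moreover note m[THEN length_takeWhile_less]
          ultimately show ?thesis
            using C_own_valid_woman[OF jv] C_own_valid_woman[OF j'] WP(3)[OF woman_less[OF jv]]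
            unfolding w by auto
        next
          case 3
          then show ?thesis
            using C_own_valid_bounds[OF jv, of v] C_other_valid_bounds[OF v j'] by auto
        next
          case 4
          then show ?thesis
            using C_own_valid_bounds[OF j', of v] C_other_valid_bounds[OF v jv] by auto
        next
          case 5
          then show ?thesis using C_other_valid_less[OF v jv _ j' _ that(1)] by auto
        qed
      qed
    qed
  qed
  show ?thesis
    by (rule linorder_inj_onI') (use neq in auto)
qed

sublocale distinct_row_entries C
  by unfold_locales (simp add: inj_C_row)

end

section \<open>Signs of the kernel of the incidence matrix\<close>

text \<open>Summing the inequality \<open>le\<close> over all rows leaves no room for strictness.\<close>

lemma substochastic_subsolution_fixed:
  fixes P :: "'a \<Rightarrow> 'a \<Rightarrow> real"
  assumes V: "finite V" and nonneg: "\<And>v. v \<in> V \<Longrightarrow> 0 \<le> \<eta> v"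
    and cols: "\<And>w. w \<in> V \<Longrightarrow> (\<Sum>v\<in>V. P v w) \<le> 1"
    and le: "\<And>v. v \<in> V \<Longrightarrow> \<eta> v \<le> (\<Sum>w\<in>V. P v w * \<eta> w)"
    and v: "v \<in> V"
  shows "\<eta> v = (\<Sum>w\<in>V. P v w * \<eta> w)"
proof -
  have "(\<Sum>v\<in>V. \<Sum>w\<in>V. P v w * \<eta> w) = (\<Sum>w\<in>V. (\<Sum>v\<in>V. P v w) * \<eta> w)"
    by (subst sum.swap) (simp add: sum_distrib_right)
  also have "\<dots> \<le> (\<Sum>w\<in>V. 1 * \<eta> w)"
    using nonneg cols by (intro sum_mono mult_right_mono) auto
  finally have "(\<Sum>v\<in>V. (\<Sum>w\<in>V. P v w * \<eta> w) - \<eta> v) \<le> 0" by (simp add: sum_subtractf)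
  moreover have "0 \<le> (\<Sum>v\<in>V. (\<Sum>w\<in>V. P v w * \<eta> w) - \<eta> v)" using le by (intro sum_nonneg) auto
  ultimately have "(\<Sum>v\<in>V. (\<Sum>w\<in>V. P v w * \<eta> w) - \<eta> v) = 0" by simp
  then show ?thesis
    using sum_nonneg_eq_0_iff[OF V, of "\<lambda>v. (\<Sum>w\<in>V. P v w * \<eta> w) - \<eta> v"] le v by auto
qed

context marriage
begin

lemma A_entry: "v < 2 * k \<Longrightarrow> j < num_cols k \<Longrightarrow> A $$ (v, j) = (if inc v j then 1 else 0)"
  by (simp add: A_mat_def)

lemma incident_two_agents:
  assumes "j < num_cols k" "inc v j" "inc w j" "v \<noteq> w"
  shows "(v < k) \<noteq> (w < k)"
  using assms col_cases[OF assms(1)] man_less[of j] by (auto simp: inc_loop inc_valid)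

text \<open>After changing the sign of the women's rows and columns, the columns \<open>d v\<close> form the matrix
  \<open>1 - P\<close> with \<open>P\<close> column-substochastic.\<close>

lemma kernel_sign:
  assumes F: "F \<subseteq> {..<num_cols k}" and d: "bij_betw d {..<2 * k} F"
    and d_inc: "\<And>v. v < 2 * k \<Longrightarrow> inc v (d v)"
    and i: "i < k" "i \<notin> F" and t: "t < k"
    and indep: "\<And>z. (\<And>v. v < 2 * k \<Longrightarrow> (\<Sum>j\<in>insert i F - {d t}. A $$ (v, j) * z j) = 0) \<Longrightarrow>
       (\<And>j. j \<in> insert i F - {d t} \<Longrightarrow> z j = 0)"
    and z: "\<And>v. v < 2 * k \<Longrightarrow> (\<Sum>j\<in>insert i F. A $$ (v, j) * z j) = 0"
    and zt: "z (d t) < 0" and p: "p < k"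
  shows "z (d p) \<le> 0"
proof -
  let ?V = "{..<2 * k}"
  define s :: "nat \<Rightarrow> real" where "s v = (if v < k then 1 else - 1)" for v
  define P :: "nat \<Rightarrow> nat \<Rightarrow> real" where "P v w = (if w \<noteq> v \<and> inc v (d w) then 1 else 0)" for v w
  define e where "e = inv_into ?V d"
  have finF: "finite F" using F finite_subset by auto
  have dF: "d v \<in> F" if "v < 2 * k" for v using d that by (auto simp: bij_betw_def)
  have dN: "d v < num_cols k" if "v < 2 * k" for v using dF[OF that] F by auto
  have d_ne_i: "d v \<noteq> i" if "v < 2 * k" for v using dF[OF that] i(2) by auto
  have ed: "e (d v) = v" if "v < 2 * k" for v
    unfolding e_def using d that by (auto simp: bij_betw_def intro!: inv_into_f_f)
  have ss: "s v * s v = 1" for v by (simp add: s_def)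
  have P_nonneg: "0 \<le> P v w" for v w by (simp add: P_def)
  \<comment> \<open>Row \<open>v\<close> of the system, times \<open>s v\<close>. The two agents of
    a valid column have opposite signs, so each off-diagonal incidence contributes
    \<open>- P v w\<close>. The loop of \<open>i\<close> keeps its sign, \<open>i\<close> being a
    man.\<close>
  have row: "s v * (\<Sum>j\<in>insert i F. A $$ (v, j) * \<zeta> j)
      = s v * \<zeta> (d v) - (\<Sum>w\<in>?V. P v w * (s w * \<zeta> (d w))) + (if v = i then \<zeta> i else 0)"
    if v: "v < 2 * k" for v and \<zeta> :: "nat \<Rightarrow> real"
  proof -
    have "(\<Sum>j\<in>insert i F. A $$ (v, j) * \<zeta> j) = (if v = i then \<zeta> i else 0) + (\<Sum>j\<in>F. A $$ (v, j) * \<zeta> j)"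
      using finF i v by (simp add: A_entry inc_loop loop_less_num_cols)
    also have "(\<Sum>j\<in>F. A $$ (v, j) * \<zeta> j) = (\<Sum>w\<in>?V. A $$ (v, d w) * \<zeta> (d w))"
      using sum.reindex_bij_betw[OF d, of "\<lambda>j. A $$ (v, j) * \<zeta> j"] by simp
    also have "\<dots> = (\<Sum>w\<in>?V. (if w = v then \<zeta> (d v) else 0) + P v w * \<zeta> (d w))"
      using v by (intro sum.cong) (auto simp: A_entry dN P_def d_inc)
    also have "\<dots> = \<zeta> (d v) + (\<Sum>w\<in>?V. P v w * \<zeta> (d w))"
      using v by (simp add: sum.distrib)
    finally have "s v * (\<Sum>j\<in>insert i F. A $$ (v, j) * \<zeta> j)
        = s v * \<zeta> (d v) + s v * (\<Sum>w\<in>?V. P v w * \<zeta> (d w)) + s v * (if v = i then \<zeta> i else 0)"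
      by (simp add: algebra_simps)
    moreover have "s v * (\<Sum>w\<in>?V. P v w * \<zeta> (d w)) = - (\<Sum>w\<in>?V. P v w * (s w * \<zeta> (d w)))"
      unfolding sum_distrib_left sum_negf[symmetric]
    proof (intro sum.cong refl)
      fix w assume w: "w \<in> ?V"
      have "s v = - s w" if "P v w \<noteq> 0"
        using that w incident_two_agents[of "d w" v w] dN[of w] d_inc[of w]
        by (auto simp: P_def s_def split: if_splits)
      then show "s v * (P v w * \<zeta> (d w)) = - (P v w * (s w * \<zeta> (d w)))" by (cases "P v w = 0") auto
    qed
    ultimately show ?thesis using i(1) by (auto simp: s_def)
  qed
  have cols: "(\<Sum>v\<in>?V. P v w) \<le> 1" if "w \<in> ?V" for w
  proof -
    have w: "w < 2 * k" using that by simp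
    let ?S = "{v \<in> ?V. v \<noteq> w \<and> inc v (d w)}"
    have "(\<Sum>v\<in>?V. P v w) = (\<Sum>v\<in>?S. 1)"
      by (intro sum.mono_neutral_cong_right) (auto simp: P_def)
    moreover have "card ?S \<le> Suc 0"
    proof -
      have "x = y" if x: "x \<in> ?S" and y: "y \<in> ?S" for x y
        using incident_two_agents[OF dN[OF w], of x w] incident_two_agents[OF dN[OF w], of y w]
          incident_two_agents[OF dN[OF w], of x y] d_inc[OF w] x y by auto
      then show ?thesis by (subst card_le_Suc0_iff_eq) auto
    qed
    ultimately show ?thesis by simp
  qed
  \<comment> \<open>These equations describe a kernel vector; if it vanishes at \<open>d t\<close>,
    its support lies in the independent set \<open>insert i F - {d t}\<close>.\<close>
  have null: "\<zeta> j = 0"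
    if \<zeta>: "\<And>v. v < 2 * k \<Longrightarrow> s v * \<zeta> (d v) = (\<Sum>w\<in>?V. P v w * (s w * \<zeta> (d w))) - (if v = i then \<zeta> i else 0)"
      and \<zeta>t: "\<zeta> (d t) = 0" and j: "j \<in> insert i F" for \<zeta> :: "nat \<Rightarrow> real" and j
  proof (cases "j = d t")
    case False
    have "(\<Sum>j\<in>insert i F - {d t}. A $$ (v, j) * \<zeta> j) = 0" if v: "v < 2 * k" for v
    proof -
      have "(\<Sum>j\<in>insert i F - {d t}. A $$ (v, j) * \<zeta> j) = (\<Sum>j\<in>insert i F. A $$ (v, j) * \<zeta> j)"
        using finF \<zeta>t by (intro sum.mono_neutral_left) auto
      moreover have "s v * (\<Sum>j\<in>insert i F. A $$ (v, j) * \<zeta> j) = 0" using row[OF v] \<zeta>[OF v] by simp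
      ultimately show ?thesis using ss[of v] by auto
    qed
    moreover have "j \<in> insert i F - {d t}" using False j by simp
    ultimately show ?thesis by (rule indep)
  qed (use \<zeta>t in simp)
  define y where "y v = s v * z (d v)" for v
  have y: "y v = (\<Sum>w\<in>?V. P v w * y w) - (if v = i then z i else 0)" if v: "v < 2 * k" for v
    using row[OF v, of z] z[OF v] by (simp add: y_def)
  have yt: "y t < 0" using zt t by (simp add: y_def s_def)
  have fixed: "\<eta> v = (\<Sum>w\<in>?V. P v w * \<eta> w)"
    if "\<And>v. v < 2 * k \<Longrightarrow> 0 \<le> \<eta> v" "\<And>v. v < 2 * k \<Longrightarrow> \<eta> v \<le> (\<Sum>w\<in>?V. P v w * \<eta> w)" "v < 2 * k" for \<eta> v
    using substochastic_subsolution_fixed[of ?V \<eta> P v] cols that by auto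
  show ?thesis
  proof (cases "0 \<le> z i")
    case True
    \<comment> \<open>With \<open>0 \<le> z i\<close> the positive part of \<open>y\<close> is a
      subsolution, hence a fixed point, hence a kernel vector with value 0 at the loop of
      \<open>i\<close>. It vanishes at \<open>t\<close> because \<open>y t < 0\<close>, so it is
      zero everywhere.\<close>
    define \<eta> where "\<eta> v = max (y v) 0" for v
    have "\<eta> v \<le> (\<Sum>w\<in>?V. P v w * \<eta> w)" if v: "v < 2 * k" for v
    proof -
      have "(\<Sum>w\<in>?V. P v w * y w) \<le> (\<Sum>w\<in>?V. P v w * \<eta> w)"
        by (intro sum_mono mult_left_mono) (auto simp: \<eta>_def P_nonneg)
      moreover have "0 \<le> (\<Sum>w\<in>?V. P v w * \<eta> w)" by (intro sum_nonneg) (auto simp: \<eta>_def P_nonneg)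
      ultimately show ?thesis using y[OF v] True by (auto simp: \<eta>_def)
    qed
    then have \<eta>: "\<eta> v = (\<Sum>w\<in>?V. P v w * \<eta> w)" if "v < 2 * k" for v
      using fixed[of \<eta> v] that by (auto simp: \<eta>_def)
    define \<zeta> where "\<zeta> j = (if j = i then 0 else s (e j) * \<eta> (e j))" for j
    have \<zeta>d: "s v * \<zeta> (d v) = \<eta> v" if "v < 2 * k" for v
      using that ed d_ne_i ss[of v] by (simp add: \<zeta>_def flip: mult.assoc)
    have pV: "p < 2 * k" and tV: "t < 2 * k" using p t by auto
    have "s t * \<zeta> (d t) = 0" using \<zeta>d[OF tV] yt by (simp add: \<eta>_def)
    then have "\<zeta> (d t) = 0" using ss[of t] by auto
    moreover have "s v * \<zeta> (d v) = (\<Sum>w\<in>?V. P v w * (s w * \<zeta> (d w))) - (if v = i then \<zeta> i else 0)"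
      if "v < 2 * k" for v
    proof -
      have "(\<Sum>w\<in>?V. P v w * (s w * \<zeta> (d w))) = (\<Sum>w\<in>?V. P v w * \<eta> w)"
        by (intro sum.cong) (simp_all add: \<zeta>d)
      then show ?thesis using \<zeta>d[OF that] \<eta>[OF that] by (simp add: \<zeta>_def)
    qed
    ultimately have "\<zeta> (d p) = 0" using null[of \<zeta> "d p"] dF[OF pV] by blast
    then have "\<eta> p = 0" using \<zeta>d[OF pV] by simp
    then show ?thesis using p by (simp add: \<eta>_def y_def s_def max_def split: if_splits)
  next
    case False
    \<comment> \<open>With \<open>z i < 0\<close> the negative part of \<open>y\<close> is the
      subsolution. Adding it to \<open>y\<close> cancels the negative value at \<open>t\<close> and
      keeps \<open>z i\<close>, so the resulting kernel vector is zero, contradicting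
      \<open>z i < 0\<close>.\<close>
    define \<eta> where "\<eta> v = max (- y v) 0" for v
    have "\<eta> v \<le> (\<Sum>w\<in>?V. P v w * \<eta> w)" if v: "v < 2 * k" for v
    proof -
      have "(\<Sum>w\<in>?V. P v w * - y w) \<le> (\<Sum>w\<in>?V. P v w * \<eta> w)"
        by (intro sum_mono mult_left_mono) (auto simp: \<eta>_def P_nonneg)
      moreover have "0 \<le> (\<Sum>w\<in>?V. P v w * \<eta> w)" by (intro sum_nonneg) (auto simp: \<eta>_def P_nonneg)
      ultimately show ?thesis using y[OF v] False by (auto simp: \<eta>_def sum_negf)
    qed
    then have \<eta>: "\<eta> v = (\<Sum>w\<in>?V. P v w * \<eta> w)" if "v < 2 * k" for v
      using fixed[of \<eta> v] that by (auto simp: \<eta>_def)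
    define \<zeta> where "\<zeta> j = (if j = i then z i else z j + s (e j) * \<eta> (e j))" for j
    have \<zeta>d: "s v * \<zeta> (d v) = y v + \<eta> v" if "v < 2 * k" for v
      using that ed d_ne_i ss[of v] by (simp add: \<zeta>_def y_def distrib_left flip: mult.assoc)
    have tV: "t < 2 * k" using t by auto
    have "s t * \<zeta> (d t) = 0" using \<zeta>d[OF tV] yt by (simp add: \<eta>_def)
    then have "\<zeta> (d t) = 0" using ss[of t] by auto
    moreover have "s v * \<zeta> (d v) = (\<Sum>w\<in>?V. P v w * (s w * \<zeta> (d w))) - (if v = i then \<zeta> i else 0)"
      if v: "v < 2 * k" for v
    proof -
      have "(\<Sum>w\<in>?V. P v w * (s w * \<zeta> (d w))) = (\<Sum>w\<in>?V. P v w * y w + P v w * \<eta> w)"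
        by (intro sum.cong) (simp_all add: \<zeta>d distrib_left)
      then show ?thesis using \<zeta>d[OF v] \<eta>[OF v] y[OF v] by (simp add: \<zeta>_def sum.distrib)
    qed
    ultimately have "\<zeta> i = 0" using null[of \<zeta> i] by blast
    then show ?thesis using False by (simp add: \<zeta>_def)
  qed
qed

end

section \<open>Pairs of a feasible and an ordinal basis\<close>

context marriage
begin

lemma k_le_k2: "k \<le> k\<^sup>2"
  using k by (simp add: power2_eq_square)

lemma inc_if_entry_le:
  assumes "v < 2 * k" "j < num_cols k" "C $$ (v, j) \<le> k"
  shows "inc v j"
  using assms col_cases[OF assms(2)] C_other_loop_gt[OF assms(1), of j] C_other_valid_bounds[OF assms(1), of j] k_le_k2
  by (cases "j = v") (force simp: inc_loop)+

lemma entry_le_if_inc: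
  assumes "v < 2 * k" "j < num_cols k" "inc v j"
  shows "C $$ (v, j) \<le> k"
  using col_cases[OF assms(2)] C_own_loop[OF assms(1)] C_own_valid_bounds(2)[of j v] assms(3)
  by (auto simp: inc_loop)

lemma valid_entry_le:
  assumes "v < 2 * k" "j \<in> valid_cols k"
  shows "C $$ (v, j) \<le> k\<^sup>2"
  using C_own_valid_bounds(2)[OF assms(2), of v] C_other_valid_bounds(2)[OF assms] k_le_k2
  by (cases "inc v j") auto

lemma feasible_solution:
  assumes "feasible_basis A b B"
  shows "\<exists>x. (\<forall>j\<in>B. 0 \<le> x j) \<and> (\<forall>v<2 * k. (\<Sum>j\<in>B. A $$ (v, j) * x j) = 1)"
  using assms[unfolded feasible_basis_iff[of b A, simplified]] by (simp add: b_vec_def)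

lemma feasible_subset:
  assumes "feasible_basis A b B"
  shows "B \<subseteq> {..<num_cols k}" "finite B" "card B = 2 * k"
  using assms finite_subset[of B "{..<num_cols k}"] by (auto simp: feasible_basis_def)

lemma feasible_covers:
  assumes "feasible_basis A b B" "v < 2 * k"
  obtains j where "j \<in> B" "inc v j"
proof -
  obtain x where x: "\<forall>v<2 * k. (\<Sum>j\<in>B. A $$ (v, j) * x j) = 1"
    using feasible_solution[OF assms(1)] by blast
  have "\<exists>j\<in>B. A $$ (v, j) * x j \<noteq> 0"
  proof (rule ccontr)
    assume "\<not> ?thesis"
    then have "(\<Sum>j\<in>B. A $$ (v, j) * x j) = 0" by (intro sum.neutral) simp
    then show False using x assms(2) by simp
  qed
  then show ?thesis
    using that feasible_subset(1)[OF assms(1)] assms(2) by (auto simp: A_entry subset_iff split: if_splits)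
qed

lemma feasible_basis_loops: "feasible_basis A b {..<2 * k}"
proof -
  have *: "(\<Sum>j<2 * k. A $$ (v, j) * z j) = z v" if "v < 2 * k" for v and z :: "nat \<Rightarrow> real"
  proof -
    have "(\<Sum>j<2 * k. A $$ (v, j) * z j) = (\<Sum>j<2 * k. if j = v then z v else 0)"
      using that by (intro sum.cong) (auto simp: A_entry loop_less_num_cols inc_loop)
    then show ?thesis using that by simp
  qed
  show ?thesis
    unfolding feasible_basis_iff[of b A, simplified]
    using * by (auto simp: num_cols_def b_vec_def intro!: exI[of _ "\<lambda>_. 1"])
qed

lemma ordinal_num_cols: "ordinal_basis C D \<Longrightarrow> j \<in> D \<Longrightarrow> j < num_cols k"
  using ordinal_subset by fastforce

text \<open>Only \<open>2 * k - 1\<close> columns have entries above \<open>k\<^sup>2\<close> in row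
  0, so some column of \<open>D\<close> does not. Hence the test in the pivoting rule amounts to
  \<open>k < u D 0\<close>, the form used below.\<close>

lemma utility_0_le:
  assumes D: "ordinal_basis C D"
  shows "u D 0 \<le> k\<^sup>2"
proof (cases "D \<subseteq> {1..<2 * k}")
  case True
  then have "card D \<le> 2 * k - 1" using card_mono[of "{1..<2 * k}" D] by simp
  then show ?thesis using ordinal_card[OF D] k by simp
next
  case False
  then obtain j where j: "j \<in> D" "j = 0 \<or> j \<in> valid_cols k"
    using col_cases ordinal_num_cols[OF D] by fastforce
  then have "C $$ (0, j) \<le> k\<^sup>2" using C_own_loop[of 0] valid_entry_le[of 0 j] k by auto
  then show ?thesis using utility_le[OF ordinal_finite[OF D] j(1), of C 0] by simp
qed

text \<open>Holds before and after a pivot, and also once \<open>B = D\<close>, so that the facts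
  below apply to both ends of an iteration. The loop 0 is the one column of \<open>B\<close> that
  may be missing from \<open>D\<close>.\<close>

definition covering_pair :: "nat set \<Rightarrow> nat set \<Rightarrow> bool" where
  "covering_pair B D \<longleftrightarrow> feasible_basis A b B \<and> ordinal_basis C D \<and> B \<subseteq> insert 0 D"

context
  fixes B D assumes BD: "covering_pair B D"
begin

lemma pair_feasible: "feasible_basis A b B" and pair_ordinal: "ordinal_basis C D"
  and pair_subset: "B \<subseteq> insert 0 D"
  using BD by (auto simp: covering_pair_def)

lemma pair_covers:
  assumes "1 \<le> v" "v < 2 * k"
  obtains j where "j \<in> B" "j \<in> D" "inc v j"
proof -
  obtain j where j: "j \<in> B" "inc v j" using feasible_covers[OF pair_feasible assms(2)] .
  then have "j \<noteq> 0" using assms k inc_loop[of 0 v] by (intro notI) auto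
  then show ?thesis using that j pair_subset by blast
qed

lemma utility_le_k:
  assumes "1 \<le> v" "v < 2 * k"
  shows "u D v \<le> k"
proof -
  obtain j where "j \<in> D" "inc v j" using pair_covers[OF assms] .
  then show ?thesis
    using utility_le[OF ordinal_finite[OF pair_ordinal], of j C v]
      entry_le_if_inc[OF assms(2) ordinal_num_cols[OF pair_ordinal], of j] by simp
qed

lemma inc_worst_if_le:
  assumes "v < 2 * k" "u D v \<le> k"
  shows "inc v (worst C D v)"
  using assms entry_worst[OF pair_ordinal, of v] worst_in[OF pair_ordinal, of v]
  by (intro inc_if_entry_le) (auto intro: ordinal_num_cols[OF pair_ordinal])

lemma inc_worst:
  assumes "1 \<le> v" "v < 2 * k"
  shows "inc v (worst C D v)"
  using assms utility_le_k by (intro inc_worst_if_le)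

lemma worst_loop:
  assumes "v \<in> D" "v < 2 * k"
  shows "worst C D v = v"
  using assms C_own_loop[OF assms(2)] by (intro worst_eqI ordinal_subset[OF pair_ordinal]) auto

text \<open>While the first man has no edge in \<open>D\<close>, he dislikes the rightmost valid column of \<open>D\<close>; the
  separator turns out to be the man of that column.\<close>

context
  assumes u0: "k < u D 0"
begin

text \<open>The utility of row 0 lies above the entries of its own edges and does not exceed
  \<open>k\<^sup>2\<close>, a range met only by valid columns without man 0.\<close>

lemma rightmost_valid: "worst C D 0 \<in> valid_cols k"
  and rightmost_in: "worst C D 0 \<in> D"
  and rightmost_not_inc: "\<not> inc 0 (worst C D 0)"
proof -
  have w: "C $$ (0, worst C D 0) = u D 0" and in_D: "worst C D 0 \<in> D"
    using entry_worst[OF pair_ordinal, of 0] worst_in[OF pair_ordinal, of 0] k by auto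
  have n: "worst C D 0 < num_cols k" using ordinal_num_cols[OF pair_ordinal in_D] .
  show "worst C D 0 \<in> D" by (rule in_D)
  show "\<not> inc 0 (worst C D 0)" using entry_le_if_inc[OF _ n, of 0] w u0 k by auto
  show "worst C D 0 \<in> valid_cols k"
  proof (rule ccontr)
    assume "worst C D 0 \<notin> valid_cols k"
    then have "worst C D 0 < 2 * k" using col_cases[OF n] by simp
    then show False
      using C_other_loop_gt[of 0 "worst C D 0"] C_own_loop[of 0] w u0 utility_0_le[OF pair_ordinal] k
      by (cases "worst C D 0 = 0") auto
  qed
qed

lemma man_rightmost: "1 \<le> man (worst C D 0)" "man (worst C D 0) < k"
  using rightmost_not_inc man_less[OF rightmost_valid] inc_man[OF rightmost_valid, of 0] k by auto

lemma man_nonzero: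
  assumes "e \<in> D" "e \<in> valid_cols k"
  shows "man e \<noteq> 0"
proof
  assume "man e = 0"
  then have "inc 0 e" using assms by (simp add: inc_valid)
  then have "C $$ (0, e) \<le> k" using C_own_valid_bounds(2)[OF assms(2)] by simp
  then show False using utility_le[OF ordinal_finite[OF pair_ordinal] assms(1), of C 0] u0 by simp
qed

text \<open>No valid column of \<open>D\<close> contains man 0, and on the remaining valid columns
  the entries of row 0 decrease from left to right, so the minimum sits rightmost.\<close>

lemma le_rightmost:
  assumes "e \<in> D" "e \<in> valid_cols k"
  shows "e \<le> worst C D 0"
proof (rule ccontr)
  assume "\<not> ?thesis"
  then have less: "worst C D 0 < e" by simp
  have "\<not> inc 0 e" using man_nonzero[OF assms] inc_man[OF assms(2), of 0] k by auto
  then have "C $$ (0, e) < u D 0"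
    using C_other_valid_less[OF _ rightmost_valid rightmost_not_inc assms(2) _ less] k
      entry_worst[OF pair_ordinal, of 0] by simp
  then show False using utility_le[OF ordinal_finite[OF pair_ordinal] assms(1), of C 0] by simp
qed

lemma man_rightmost_entry_le:
  assumes "e \<in> D" "e \<in> valid_cols k" "man e = man (worst C D 0)"
  shows "C $$ (man e, worst C D 0) \<le> C $$ (man e, e)"
  using le_rightmost[OF assms(1,2)] C_own_man_less[OF assms(2) rightmost_valid assms(3)]
  by (cases "e = worst C D 0") auto

text \<open>A man's block runs from his best to his worst edge. If \<open>?m\<close> disliked a
  valid edge, it would therefore be \<open>?r\<close>; but \<open>?r\<close> is disliked by man 0,
  and no column is disliked by two rows. So \<open>?m\<close> dislikes his loop.\<close>

lemma man_rightmost_loop: "man (worst C D 0) \<in> D"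
proof -
  let ?r = "worst C D 0"
  let ?m = "man ?r"
  have m: "1 \<le> ?m" "?m < 2 * k" using man_rightmost by auto
  let ?e = "worst C D ?m"
  have e: "?e \<in> D" "inc ?m ?e" using worst_in[OF pair_ordinal, of ?m] inc_worst[OF m] m by auto
  have "?e \<noteq> ?r" using worst_inj[OF pair_ordinal, of ?m 0] m k by auto
  have "?e < 2 * k"
  proof (rule ccontr)
    assume "\<not> ?thesis"
    then have v: "?e \<in> valid_cols k" using col_cases ordinal_num_cols[OF pair_ordinal e(1)] by blast
    then have "man ?e = ?m" using e(2) man_rightmost by (simp add: inc_man)
    then have "C $$ (?m, ?r) \<le> u D ?m"
      using man_rightmost_entry_le[OF e(1) v] entry_worst[OF pair_ordinal, of ?m] m by simp
    then have "?e = ?r"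
      using m rightmost_in by (intro worst_eqI ordinal_subset[OF pair_ordinal]) auto
    then show False using \<open>?e \<noteq> ?r\<close> by simp
  qed
  then have "?e = ?m" using e(2) by (simp add: inc_loop)
  then show ?thesis using e(1) by simp
qed

text \<open>If a man \<open>v\<close> to the left of the separator had exhausted his list, every woman would prefer
  her disliked edge to \<open>v\<close>, so all \<open>k\<close> women would have to be covered by the \<open>k - 1\<close> men that have
  edges in \<open>D\<close>.\<close>

lemma no_loop_left_of_rightmost:
  assumes v: "1 \<le> v" "v < man (worst C D 0)"
  shows "v \<notin> D"
proof
  assume vD: "v \<in> D"
  have vk: "v < k" using v man_rightmost by simp
  have uv: "u D v = 0"
    using worst_loop[OF vD] entry_worst[OF pair_ordinal, of v] C_own_loop[of v] vk by simp
  \<comment> \<open>With the loops of \<open>v\<close> and \<open>k + w\<close> both in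
    \<open>D\<close>, their utilities are 0, below the entries of the edge between them. Row 0 does
    not dominate this edge, as it lies left of the rightmost column, and no other row can, its
    utility being at most \<open>k\<close>.\<close>
  have no_loop: "k + w \<notin> D" if w: "w < k" for w
  proof
    assume "k + w \<in> D"
    then have uw: "u D (k + w) = 0"
      using worst_loop entry_worst[OF pair_ordinal, of "k + w"] C_own_loop[of "k + w"] w by simp
    obtain j where j: "j \<in> valid_cols k" "man j = v" "woman j = w" using valid_col_exists[OF vk w] .
    obtain i where i: "i < 2 * k" "C $$ (i, j) \<le> u D i"
      using ordinal_dominated[OF pair_ordinal, of j] j(1) by (auto simp: valid_iff)
    have "i = 0"
    proof (rule ccontr)
      assume i0: "i \<noteq> 0"
      then have "inc i j"
        using i utility_le_k[of i] j(1) by (intro inc_if_entry_le) (auto simp: valid_iff)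
      then have "i = v \<or> i = k + w" "1 \<le> C $$ (i, j)"
        using j C_own_valid_bounds(1)[of j i] by (auto simp: inc_valid)
      then show False using i uv uw by auto
    qed
    have "\<not> inc 0 j" using j v k by (simp add: inc_man)
    moreover have "j < worst C D 0"
      using man_mono[of "worst C D 0" j] j(2) v(2) by (meson leD leI)
    ultimately have "u D 0 < C $$ (0, j)"
      using C_other_valid_less[of 0 j "worst C D 0"] j(1) rightmost_valid rightmost_not_inc k
        entry_worst[OF pair_ordinal, of 0] by simp
    then show False using i \<open>i = 0\<close> by simp
  qed
  obtain x where x: "\<forall>j\<in>B. 0 \<le> x j" "\<forall>v<2 * k. (\<Sum>j\<in>B. A $$ (v, j) * x j) = 1"
    using feasible_solution[OF pair_feasible] by blast
  \<comment> \<open>A loop in \<open>B\<close> is that of a man and covers no woman; a valid column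
    in \<open>B\<close> covers one woman and one man other than 0.\<close>
  have le: "(\<Sum>w<k. A $$ (k + w, j)) \<le> (\<Sum>p\<in>{1..<k}. A $$ (p, j))" if j: "j \<in> B" for j
  proof -
    have jn: "j < num_cols k" using feasible_subset(1)[OF pair_feasible] j by auto
    show ?thesis
    proof (cases "j < 2 * k")
      case True
      have "j < k"
      proof (rule ccontr)
        assume "\<not> j < k"
        then have "j = k + (j - k)" "j - k < k" "j \<noteq> 0" using True k by auto
        then show False using no_loop[of "j - k"] pair_subset j by auto
      qed
      then have "(\<Sum>w<k. A $$ (k + w, j)) = 0"
        using True jn by (intro sum.neutral) (auto simp: A_entry inc_loop)
      also have "\<dots> \<le> (\<Sum>p\<in>{1..<k}. A $$ (p, j))"
        using jn by (intro sum_nonneg) (auto simp: A_entry)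
      finally show ?thesis .
    next
      case False
      then have jv: "j \<in> valid_cols k" using jn by (simp add: valid_iff)
      have jD: "j \<in> D" using False j pair_subset k by auto
      have "(\<Sum>w<k. A $$ (k + w, j)) = (\<Sum>w<k. if w = woman j then 1 else 0)"
        using jn jv by (intro sum.cong) (auto simp: A_entry inc_woman)
      also have "\<dots> = 1" using woman_less[OF jv] by simp
      also have "1 = A $$ (man j, j)"
        using jn jv man_less[OF jv] by (simp add: A_entry inc_valid)
      also have "\<dots> \<le> (\<Sum>p\<in>{1..<k}. A $$ (p, j))"
        using man_nonzero[OF jD jv] man_less[OF jv] jn
        by (intro member_le_sum) (auto simp: A_entry)
      finally show ?thesis .
    qed
  qed
  \<comment> \<open>Fractional double counting: every row of the solution sums to 1, so weighting
    the columns by \<open>x\<close> counts \<open>S\<close>.\<close>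
  have swap: "(\<Sum>j\<in>B. (\<Sum>v\<in>S. A $$ (f v, j)) * x j) = real (card S)"
    if "\<And>v. v \<in> S \<Longrightarrow> f v < 2 * k" for S :: "nat set" and f
  proof -
    have "(\<Sum>j\<in>B. (\<Sum>v\<in>S. A $$ (f v, j)) * x j) = (\<Sum>v\<in>S. \<Sum>j\<in>B. A $$ (f v, j) * x j)"
      by (subst sum.swap) (simp add: sum_distrib_right)
    also have "\<dots> = (\<Sum>v\<in>S. 1)" using that by (intro sum.cong) (auto simp: x(2))
    finally show ?thesis by simp
  qed
  have "real k = (\<Sum>j\<in>B. (\<Sum>w<k. A $$ (k + w, j)) * x j)"
    using swap[of "{..<k}" "\<lambda>w. k + w"] by simp
  also have "\<dots> \<le> (\<Sum>j\<in>B. (\<Sum>p\<in>{1..<k}. A $$ (p, j)) * x j)"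
    using le x(1) by (intro sum_mono mult_right_mono) auto
  also have "\<dots> = real (k - 1)" using swap[of "{1..<k}" "\<lambda>p. p"] by simp
  finally show False using k by simp
qed

lemma separator_iff: "separator k D i \<longleftrightarrow> i = man (worst C D 0)"
proof -
  let ?m = "man (worst C D 0)"
  have "?m \<in> {1..<k} \<inter> D" using man_rightmost man_rightmost_loop by simp
  moreover have "?m \<le> i'" if "i' \<in> {1..<k} \<inter> D" for i'
    using that no_loop_left_of_rightmost[of i'] by (auto simp: not_less[symmetric])
  ultimately show ?thesis unfolding separator_def by (auto intro: le_antisym)
qed

end

end

end

section \<open>Runs of the algorithm\<close>

lemma eq_exchange:
  assumes "B - D = {a}" "D - B = {t}"
  shows "B = insert a (D - {t})" "a \<notin> D" "t \<in> D"
  using assms by blast+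

section \<open>Invariant, potential, and existence of the next pivot\<close>

context marriage
begin

text \<open>That a man dislikes the entering column is what \<open>kernel_sign\<close> needs. The
  last clause keeps the entering column different from the loop of the separator, so that it still
  belongs to a man after the reassignment of disliked columns in
  \<open>positive_coordinate\<close>.\<close>

definition scarf_invariant :: "nat set \<Rightarrow> nat set \<Rightarrow> bool" where
  "scarf_invariant B D \<longleftrightarrow> feasible_basis A b B \<and> ordinal_basis C D \<and>
     (B = D \<or> B - D = {0} \<and> (\<exists>t. D - B = {t} \<and> (\<exists>p<k. worst C D p = t) \<and> (k < u D 0 \<longrightarrow> 2 * k \<le> t)))"

text \<open>In each ordinal pivot a woman's utility rises or that of row 0 falls, and none of these
  terms moves the other way. The subtraction is exact by \<open>utility_0_le\<close>.\<close>

definition potential :: "nat set \<Rightarrow> nat" where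
  "potential D = (\<Sum>v\<in>{k..<2 * k}. u D v) + (k\<^sup>2 - u D 0)"

lemma invariant_pair: "scarf_invariant B D \<Longrightarrow> covering_pair B D"
  by (auto simp: scarf_invariant_def covering_pair_def)

lemma potential_le:
  assumes "scarf_invariant B D"
  shows "potential D \<le> 2 * k\<^sup>2"
proof -
  have "(\<Sum>v\<in>{k..<2 * k}. u D v) \<le> (\<Sum>v\<in>{k..<2 * k}. k)"
    using utility_le_k[OF invariant_pair[OF assms]] k by (intro sum_mono) auto
  then show ?thesis by (simp add: potential_def power2_eq_square)
qed

lemma invariant_init: "case scarf_init k MP WP of (B, D) \<Rightarrow> scarf_invariant B D"
proof -
  let ?P = "\<lambda>j. j \<in> valid_cols k"
  define j0 where "j0 = arg_max (\<lambda>j. C $$ (0, j)) ?P"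
  let ?B = "{..<2 * k}" and ?D = "insert j0 {1..<2 * k}"
  have "2 * k \<in> valid_cols k" using k by (simp add: valid_iff num_cols_def)
  moreover have "\<forall>j. ?P j \<longrightarrow> C $$ (0, j) < k\<^sup>2 + 1" using valid_entry_le[of 0] k by (auto simp: less_Suc_eq_le)
  ultimately have j0: "j0 \<in> valid_cols k" "\<And>j. j \<in> valid_cols k \<Longrightarrow> C $$ (0, j) \<le> C $$ (0, j0)"
    using arg_max_nat_lemma[of ?P "2 * k" "\<lambda>j. C $$ (0, j)" "k\<^sup>2 + 1"] unfolding j0_def by blast+
  have j0_ge: "2 * k \<le> j0" "j0 < num_cols k" using j0(1) by (auto simp: valid_iff)
  have u0: "u ?D 0 = C $$ (0, j0)"
    unfolding utility_def
  proof (intro Min_eqI)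
    show "C $$ (0, j0) \<le> y" if "y \<in> (\<lambda>j. C $$ (0, j)) ` ?D" for y
      using that valid_entry_le[of 0 j0] j0(1) k C_other_loop_gt[of 0] by fastforce
  qed auto
  have dom: "\<exists>i<2 * k. C $$ (i, h) \<le> u ?D i" if h: "h < num_cols k" for h
  proof (cases "h < 2 * k")
    case True
    then show ?thesis using C_own_loop[OF True] by (intro exI[of _ h]) simp
  next
    case False
    then show ?thesis using j0(2)[of h] h k u0 by (intro exI[of _ 0]) (simp add: valid_iff)
  qed
  have "card ?D = 2 * k" using j0_ge k by simp
  then have ord: "ordinal_basis C ?D"
    using dom j0_ge k by (auto simp: ordinal_basis_def num_cols_def)
  have "worst C ?D 0 = j0"
    using u0 k by (intro worst_eqI ordinal_subset[OF ord]) auto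
  moreover have "?B - ?D = {0}" "?D - ?B = {j0}" using j0_ge k by auto
  moreover have "0 < k" using k by simp
  ultimately have "scarf_invariant ?B ?D"
    unfolding scarf_invariant_def using feasible_basis_loops ord j0_ge(1) by blast
  then show ?thesis by (simp add: scarf_init_def j0_def)
qed

text \<open>Either the loop of man 0 leaves, which ends the run, or the leaving column is disliked
  by a woman or by the separator, whose loop is in \<open>D\<close> and therefore his disliked
  column. As \<open>W\<close> is arbitrary, both versions of the rule are covered.\<close>

lemma leaves_cases:
  assumes inv: "scarf_invariant B D" and leaves: "leaves k MP WP W B D jl" and t: "D - B = {jt}"
  shows "feasible_basis A b (B - {jl} \<union> {jt})" (is ?feas) and "jl \<in> B"
    and "jl = 0 \<or> (\<exists>l\<ge>1. l < 2 * k \<and> worst C D l = jl \<and>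
      (k \<le> l \<or> k < u D 0 \<and> l = man (worst C D 0) \<and> jl = l))" (is ?cases)
proof -
  note pair = invariant_pair[OF inv]
  note D = pair_ordinal[OF pair]
  obtain i where i: "if u D 0 \<in> {k + 1..k\<^sup>2} then separator k D i else i = 0"
    and rule: "if candidate_to_leave A b B jt i then jl = i
      else jl \<in> W \<and> woman_disliked k MP WP D jl \<and> candidate_to_leave A b B jt jl"
    using leaves t unfolding leaves_def by auto
  show ?feas "jl \<in> B"
    using rule by (auto simp: candidate_to_leave_def split: if_splits)
  show ?cases
  proof (cases "jl = i")
    case True
    show ?thesis
    proof (cases "k < u D 0")
      case u0: True
      then have "separator k D i" using i utility_0_le[OF D] by simp
      then have m: "i = man (worst C D 0)" using separator_iff[OF pair u0] by simp
      then have "1 \<le> i" "i < 2 * k" "worst C D i = i"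
        using man_rightmost[OF pair u0] worst_loop[OF pair man_rightmost_loop[OF pair u0]] by auto
      then show ?thesis using u0 m True by blast
    next
      case False
      then show ?thesis using i True by simp
    qed
  next
    case False
    then obtain l where "l \<in> {k..<2 * k}" "disliked C D l jl"
      using rule by (auto simp: woman_disliked_def split: if_splits)
    then have "1 \<le> l" "l < 2 * k" "worst C D l = jl" "k \<le> l"
      using disliked_iff_worst[OF D, of l jl] k by auto
    then show ?thesis by blast
  qed
qed

text \<open>The row \<open>v\<close> that falls is a man, and it is man 0 if the separator's loop
  has left, so the potential grows. Unless the run is over, \<open>j'\<close> enters
  \<open>B\<close> next and is disliked by this \<open>v\<close>, which restores the
  invariant.\<close>

lemma pivot_step:
  assumes inv: "scarf_invariant B D" and ne: "B \<noteq> D" and leaves: "leaves k MP WP W B D jl"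
    and t: "D - B = {jt}" and B': "B' = B - {jl} \<union> {jt}" "B' \<noteq> D"
    and j': "j' \<notin> D" and D': "ordinal_basis C (D - {jl} \<union> {j'})"
  shows "scarf_invariant B' (D - {jl} \<union> {j'}) \<and> potential D < potential (D - {jl} \<union> {j'})"
proof -
  let ?D' = "D - {jl} \<union> {j'}"
  note pair = invariant_pair[OF inv]
  note D = pair_ordinal[OF pair]
  have "B - D = {0}" using inv ne by (auto simp: scarf_invariant_def)
  note BD = eq_exchange[OF this t]
  have jl0: "jl \<noteq> 0"
  proof
    assume "jl = 0"
    then show False using B' BD by auto
  qed
  then obtain l where l: "1 \<le> l" "l < 2 * k" "worst C D l = jl"
    and l_cases: "k \<le> l \<or> k < u D 0 \<and> l = man (worst C D 0) \<and> jl = l"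
    using leaves_cases(3)[OF inv leaves t] by blast
  have feas: "feasible_basis A b B'" and jlB: "jl \<in> B"
    using leaves_cases(1,2)[OF inv leaves t] B'(1) by auto
  have jl_jt: "jl \<noteq> jt"
    using jlB[unfolded BD(1)] jl0 BD(2,3) by auto
  have pair': "covering_pair B' ?D'"
    unfolding covering_pair_def using feas D' B'(1)[unfolded BD(1)] BD(3) jl_jt by auto
  obtain v where v: "v < 2 * k" "v \<noteq> l" "worst C ?D' v = j'" "worst C ?D' l = worst C D v"
    "u ?D' v < u D v" "u D l < u ?D' l"
    and unchanged: "\<forall>i<2 * k. i \<noteq> l \<longrightarrow> i \<noteq> v \<longrightarrow> u ?D' i = u D i \<and> worst C ?D' i = worst C D i"
    using ordinal_exchange[OF D _ _ j', of l] l(2) D' unfolding l(3) dims by blast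
  have same: "u ?D' i = u D i" and same_worst: "worst C ?D' i = worst C D i"
    if "i < 2 * k" "i \<noteq> l" "i \<noteq> v" for i using unchanged that by blast+
  let ?e = "worst C D v"
  have e_inc: "inc l ?e" using inc_worst[OF pair' l(1,2)] v(4) by simp
  have eD: "?e \<in> D" using worst_in[OF D] v(1) by simp
  \<comment> \<open>Its own loop would leave \<open>l\<close> with utility 0, but this utility has
    risen.\<close>
  have e_valid: "?e \<in> valid_cols k"
  proof (rule ccontr)
    assume "?e \<notin> valid_cols k"
    then have "?e < 2 * k" using col_cases ordinal_num_cols[OF D eD] by blast
    then have "?e = l" using e_inc by (simp add: inc_loop)
    then have "u ?D' l = 0"
      using entry_worst[OF D', of l] v(4) l(2) C_own_loop[OF l(2)] by simp
    then show False using v(6) by simp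
  qed
  \<comment> \<open>For a woman \<open>l\<close>, both \<open>l\<close> and, unless
    \<open>v = 0\<close>, also \<open>v\<close> are agents of \<open>?e\<close>, so \<open>v\<close>
    is its man. For the separator, \<open>worst C D 0\<close> survives in \<open>?D'\<close> and is
    his worst edge there; so it is the column he takes over, and its former owner is man 0.\<close>
  have v_man: "v < k \<and> (l < k \<longrightarrow> v = 0)"
  proof (cases "k \<le> l")
    case True
    have "v = man ?e" if "v \<noteq> 0"
      using inc_worst[OF pair, of v] that v(1,2) e_inc e_valid True man_less[OF e_valid]
      by (auto simp: inc_valid)
    then show ?thesis using man_less[OF e_valid] True k by (cases "v = 0") auto
  next
    case False
    then have u0: "k < u D 0" and lm: "l = man (worst C D 0)" "jl = l" using l_cases by auto
    have "l < k" using man_rightmost[OF pair u0] lm by simp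
    then have "man ?e = l" using e_inc e_valid by (simp add: inc_man)
    then have "C $$ (l, worst C D 0) \<le> u ?D' l"
      using man_rightmost_entry_le[OF pair u0 eD e_valid] lm entry_worst[OF D', of l] v(4) l(2) by simp
    moreover have "worst C D 0 \<in> ?D'"
      using rightmost_in[OF pair u0] rightmost_valid[OF pair u0] l(2) lm by (auto simp: valid_iff)
    ultimately have "worst C ?D' l = worst C D 0"
      using l(2) by (intro worst_eqI ordinal_subset[OF D']) auto
    then have "v = 0" using worst_inj[OF D, of v 0] v(1,4) k by simp
    then show ?thesis using k by simp
  qed
  have B'D': "B' = ?D'" if "j' = 0"
    using that BD B'(1)[unfolded BD(1)] jl_jt jl0 by auto
  have diffs: "B' - ?D' = {0}" "?D' - B' = {j'}" if "j' \<noteq> 0"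
    using that BD B'(1)[unfolded BD(1)] jl_jt jl0 j' by auto
  \<comment> \<open>Suppose \<open>j'\<close> is a loop. If \<open>v = 0\<close>, its entry exceeds
    \<open>k\<^sup>2\<close> and cannot lower row 0. Otherwise it is the loop of \<open>v\<close>
    and row 0 is unchanged. Then a \<open>v\<close> left of the separator is excluded in
    \<open>?D'\<close>, the separator's loop is already in \<open>D\<close>, and a man further right
    would have a valid column of \<open>D\<close> beyond the rightmost one.\<close>
  have j'_valid: "2 * k \<le> j'" if j'0: "j' \<noteq> 0" and u0': "k < u ?D' 0"
  proof (rule ccontr)
    assume "\<not> ?thesis"
    then have j'_loop: "j' < 2 * k" by simp
    show False
    proof (cases "v = 0")
      case True
      then have "C $$ (0, j') < u D 0"
        using v(3,5) entry_worst[OF D', of 0] k by simp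
      then show False using C_other_loop_gt[of 0 j'] j'0 j'_loop utility_0_le[OF D] k by simp
    next
      case False
      have "inc v j'" using inc_worst[OF pair', of v] v(1,3) False by simp
      then have j'v: "j' = v" using j'_loop by (simp add: inc_loop)
      have u0: "k < u D 0" and same0: "worst C ?D' 0 = worst C D 0"
        using same[of 0] same_worst[of 0] u0' False l(1) k by auto
      let ?m = "man (worst C D 0)"
      consider "v < ?m" | "v = ?m" | "?m < v" by linarith
      then show False
      proof cases
        case 1
        then show False
          using no_loop_left_of_rightmost[OF pair' u0', of v] False j'v same0 by simp
      next
        case 2
        then show False using man_rightmost_loop[OF pair u0] j' j'v by simp
      next
        case 3
        have v1: "1 \<le> v" using False by simp
        obtain e where e: "e \<in> D" "inc v e" using pair_covers[OF pair v1 v(1)] .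
        have "e \<noteq> v" using e(1) j' j'v by auto
        then have "e \<in> valid_cols k"
          using e(2) col_cases[OF ordinal_num_cols[OF D e(1)]] inc_loop[of e v] by auto
        moreover from this have "man e = v" using e(2) v_man by (simp add: inc_man)
        ultimately show False
          using man_mono[OF le_rightmost[OF pair u0 e(1)]] 3 by simp
      qed
    qed
  qed
  have inv': "scarf_invariant B' ?D'"
    unfolding scarf_invariant_def
    using feas D' B'D' diffs j'_valid v(3) v_man by (cases "j' = 0") auto
  have u0_le: "u ?D' 0 \<le> u D 0"
    using same[of 0] v(5) l(1) k by (cases "v = 0") auto
  have women_le: "u D w \<le> u ?D' w" if "w \<in> {k..<2 * k}" for w
    using that same[of w] v(6) v_man by (cases "w = l") auto
  have "potential D < potential ?D'"
  proof (cases "k \<le> l")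
    case True
    then have "(\<Sum>w\<in>{k..<2 * k}. u D w) < (\<Sum>w\<in>{k..<2 * k}. u ?D' w)"
      using women_le v(6) l(2) by (intro sum_strict_mono_ex1) auto
    then show ?thesis using u0_le by (simp add: potential_def)
  next
    case False
    then have "u ?D' 0 < u D 0" using v_man v(5) by simp
    moreover have "(\<Sum>w\<in>{k..<2 * k}. u D w) \<le> (\<Sum>w\<in>{k..<2 * k}. u ?D' w)"
      using women_le by (intro sum_mono) auto
    ultimately show ?thesis using utility_0_le[OF D] by (simp add: potential_def)
  qed
  then show ?thesis using inv' by simp
qed

lemma iteration_step:
  assumes "scarf_invariant B D" "scarf_iteration k MP WP W (B, D) (B', D')"
  shows "scarf_invariant B' D' \<and> B \<noteq> D \<and> (B' = D' \<and> D' = D \<or> potential D < potential D')"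
  using assms(2)
proof cases
  case (final jl jt)
  have "feasible_basis A b B'" using leaves_cases(1)[OF assms(1) final(3,4)] final(5) by simp
  then show ?thesis using assms(1) final by (auto simp: scarf_invariant_def)
next
  case (pivot jl jt j')
  then show ?thesis using pivot_step[OF assms(1) pivot(2-6)] by simp
qed

text \<open>The extra 1 pays for an iteration that ends the run without changing \<open>D\<close>;
  after it \<open>B = D\<close>, and no iteration follows.\<close>

lemma run_bound:
  assumes "(scarf_iteration k MP WP W ^^ T) (scarf_init k MP WP) (B, D)"
  shows "scarf_invariant B D \<and> (T \<le> potential D \<or> B = D \<and> T \<le> potential D + 1)"
  using assms
proof (induction T arbitrary: B D)
  case 0
  then show ?case using invariant_init by simp
next
  case (Suc T)
  then obtain B1 D1 where run: "(scarf_iteration k MP WP W ^^ T) (scarf_init k MP WP) (B1, D1)"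
    and it: "scarf_iteration k MP WP W (B1, D1) (B, D)" by auto
  show ?case using iteration_step[OF _ it] Suc.IH[OF run] by auto
qed

lemma run_length_le:
  assumes "(scarf_iteration k MP WP W ^^ T) (scarf_init k MP WP) (B, D)"
  shows "T \<le> (2 * k)\<^sup>2"
proof -
  have "T \<le> 2 * k\<^sup>2 + 1" using run_bound[OF assms] potential_le[of B D] by auto
  \<comment> \<open>As \<open>k\<close> is at least 1, \<open>2 * k\<^sup>2 + 1\<close> is at most
    \<open>4 * k\<^sup>2\<close>; hence the constant 1 in the theorem.\<close>
  then show ?thesis using k_le_k2 k by (simp add: power_mult_distrib)
qed

text \<open>Setting the coefficient of \<open>jt\<close> to -1 gives a kernel vector that is
  negative at a man's column, so \<open>kernel_sign\<close> makes it nonpositive at every man's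
  column. Positive coefficients remain for the loop \<open>i\<close> and for the columns of women,
  which the reassignment \<open>d\<close> does not touch.\<close>

lemma positive_coordinate:
  assumes inv: "scarf_invariant B D" and ne: "B \<noteq> D" and t: "D - B = {jt}"
    and y: "\<And>v. v < 2 * k \<Longrightarrow> (\<Sum>j\<in>B. A $$ (v, j) * y j) = A $$ (v, jt)"
    and j: "j \<in> B" "y j > 0"
  shows "j = (if k < u D 0 then man (worst C D 0) else 0) \<or> (\<exists>l\<in>{k..<2 * k}. worst C D l = j)"
proof -
  note pair = invariant_pair[OF inv]
  note D = pair_ordinal[OF pair]
  have "B - D = {0}" using inv ne by (auto simp: scarf_invariant_def)
  note BD = eq_exchange[OF this t]
  obtain p0 where p0: "p0 < k" "worst C D p0 = jt" and jt_valid: "k < u D 0 \<Longrightarrow> 2 * k \<le> jt"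
    using inv ne t by (auto simp: scarf_invariant_def)
  define i where "i = (if k < u D 0 then man (worst C D 0) else 0)"
  \<comment> \<open>The assignment of disliked columns becomes an incident one by giving the rightmost column to
    the separator instead of the first man, and to the first man his own loop.\<close>
  define d where "d = (if k < u D 0 then (worst C D)(0 := 0, i := worst C D 0) else worst C D)"
  define F where "F = insert 0 D - {i}"
  note zeroD = BD(2)
  have i_props: "i < k" "i \<in> insert 0 D"
    using man_rightmost[OF pair] man_rightmost_loop[OF pair] k by (auto simp: i_def)
  have bij: "bij_betw d {..<2 * k} F"
  proof (cases "k < u D 0")
    case False
    then show ?thesis
      using bij_betw_worst[OF D] zeroD by (simp add: d_def F_def i_def)
  next
    case True
    have i: "1 \<le> i" "i < 2 * k" "worst C D i = i" "i \<in> D"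
      using man_rightmost[OF pair True] worst_loop[OF pair man_rightmost_loop[OF pair True]]
        man_rightmost_loop[OF pair True] True by (auto simp: i_def)
    have "inj_on d {..<2 * k}"
    proof (rule inj_onI)
      fix v w assume vw: "v \<in> {..<2 * k}" "w \<in> {..<2 * k}" "d v = d w"
      have nz: "worst C D q \<noteq> 0" if "q < 2 * k" for q using worst_in[OF D, of q] that zeroD by (intro notI) auto
      show "v = w"
        using vw i(1) nz[of v] nz[of w] nz[of 0] worst_inj[OF D, of v w] worst_inj[OF D, of 0 w] worst_inj[OF D, of v 0] k True
        by (auto simp: d_def split: if_splits)
    qed
    moreover have "d ` {..<2 * k} \<subseteq> F"
    proof
      fix c assume "c \<in> d ` {..<2 * k}"
      then obtain v where v: "v < 2 * k" "c = d v" by auto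
      have "worst C D v \<noteq> i" if "v \<noteq> i" using worst_inj[OF D, of v i] i v(1) that by auto
      moreover have "worst C D 0 \<noteq> i" using worst_inj[OF D, of 0 i] i k by auto
      ultimately show "c \<in> F"
        using v worst_in[OF D, of v] worst_in[OF D, of 0] i(1) k True by (auto simp: d_def F_def)
    qed
    moreover have "card F = 2 * k"
      using zeroD i(1,4) ordinal_card[OF D] ordinal_finite[OF D] by (simp add: F_def)
    ultimately show ?thesis
      using card_subset_eq[of F "d ` {..<2 * k}"] card_image[of d "{..<2 * k}"] ordinal_finite[OF D]
      by (simp add: bij_betw_def F_def)
  qed
  have d_inc: "inc v (d v)" if v: "v < 2 * k" for v
  proof (cases "k < u D 0")
    case True
    have "inc i (worst C D 0)" using True rightmost_valid[OF pair True] by (simp add: i_def inc_valid)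
    then show ?thesis
      using True v inc_worst[OF pair, of v] k by (auto simp: d_def inc_loop)
  next
    case False
    then show ?thesis using inc_worst_if_le[OF pair v] utility_le_k[OF pair, of v] v
      by (cases "v = 0") (auto simp: d_def)
  qed
  \<comment> \<open>If man 0 dislikes \<open>jt\<close> and \<open>k < u D 0\<close>, then
    \<open>jt\<close> is the rightmost column, which \<open>d\<close> gives to the separator. The
    separator himself dislikes his loop, which differs from the valid column
    \<open>jt\<close>.\<close>
  obtain q where q: "q < k" "d q = jt"
  proof (cases "k < u D 0")
    case True
    show ?thesis
    proof (cases "p0 = 0")
      case True
      then show ?thesis using that[of i] i_props p0 \<open>k < u D 0\<close> by (auto simp: d_def)
    next
      case False
      have "p0 \<noteq> i"
        using worst_loop[OF pair man_rightmost_loop[OF pair True]] man_rightmost[OF pair True]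
          p0 jt_valid[OF True] True by (auto simp: i_def)
      then show ?thesis using that[of p0] False p0 True by (auto simp: d_def)
    qed
  next
    case False
    then show ?thesis using that[of p0] p0 by (simp add: d_def)
  qed
  have jtD: "jt \<in> D" "jt \<notin> B" using t by auto
  have iF: "insert i F = insert 0 D" using i_props by (auto simp: F_def)
  have B_eq: "insert i F - {d q} = B" unfolding iF q(2) using BD by auto
  have finB: "finite B" using feasible_subset(2)[OF pair_feasible[OF pair]] .
  define z where "z = y(jt := - 1)"
  have z0: "(\<Sum>c\<in>insert i F. A $$ (v, c) * z c) = 0" if v: "v < 2 * k" for v
  proof -
    have "insert i F = insert jt B" unfolding iF using BD by auto
    then have "(\<Sum>c\<in>insert i F. A $$ (v, c) * z c) = - A $$ (v, jt) + (\<Sum>c\<in>B. A $$ (v, c) * z c)"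
      using finB jtD by (simp add: z_def)
    also have "(\<Sum>c\<in>B. A $$ (v, c) * z c) = (\<Sum>c\<in>B. A $$ (v, c) * y c)"
      using jtD by (intro sum.cong) (auto simp: z_def)
    finally show ?thesis using y[OF v] by simp
  qed
  have indep: "z c = 0" if "\<And>v. v < 2 * k \<Longrightarrow> (\<Sum>j\<in>insert i F - {d q}. A $$ (v, j) * z j) = 0"
    "c \<in> insert i F - {d q}" for z c
    using pair_feasible[OF pair, unfolded feasible_basis_iff[of b A, simplified]] that
    unfolding B_eq by blast
  have men: "z (d p) \<le> 0" if "p < k" for p
  proof (rule kernel_sign[where F = F and d = d and i = i and t = q and z = z and p = p])
    show "F \<subseteq> {..<num_cols k}" using ordinal_num_cols[OF D] k by (auto simp: F_def num_cols_def)
    show "bij_betw d {..<2 * k} F" by (rule bij)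
    show "\<And>v. v < 2 * k \<Longrightarrow> inc v (d v)" by (rule d_inc)
    show "\<And>z j. (\<And>v. v < 2 * k \<Longrightarrow> (\<Sum>j\<in>insert i F - {d q}. A $$ (v, j) * z j) = 0) \<Longrightarrow>
      j \<in> insert i F - {d q} \<Longrightarrow> z j = 0" by (rule indep)
    show "\<And>v. v < 2 * k \<Longrightarrow> (\<Sum>j\<in>insert i F. A $$ (v, j) * z j) = 0" by (rule z0)
  qed (use that i_props(1) q in \<open>auto simp: F_def z_def\<close>)
  show ?thesis
  proof (cases "j = i")
    case False
    then have "j \<in> F" using j(1) BD by (auto simp: F_def)
    then obtain l where l: "l < 2 * k" "d l = j" using bij by (auto simp: bij_betw_def)
    have "\<not> l < k" using men[of l] l j jtD by (auto simp: z_def split: if_splits)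
    then have "l \<noteq> 0" "l \<noteq> i" using i_props k by auto
    then have "worst C D l = j" using l(2) by (auto simp: d_def split: if_splits)
    then show ?thesis using l \<open>\<not> l < k\<close> by auto
  qed (simp add: i_def)
qed

text \<open>Unless the loop \<open>i\<close> is a candidate, the column selected by the ratio test
  can leave: its coefficient is positive, so \<open>positive_coordinate\<close> shows it to be
  woman-disliked. It may be a woman's loop, hence \<open>UNIV\<close>.\<close>

lemma some_column_leaves:
  assumes inv: "scarf_invariant B D" and ne: "B \<noteq> D" and t: "D - B = {jt}"
  shows "\<exists>jl. leaves k MP WP UNIV B D jl"
proof -
  note pair = invariant_pair[OF inv]
  note D = pair_ordinal[OF pair]
  note feas = pair_feasible[OF pair]
  define i where "i = (if k < u D 0 then man (worst C D 0) else 0)"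
  have jt: "jt \<in> D" "jt \<notin> B" "jt < num_cols k" using t ordinal_num_cols[OF D] by auto
  obtain y where y: "\<And>v. v < 2 * k \<Longrightarrow> (\<Sum>j\<in>B. A $$ (v, j) * y j) = A $$ (v, jt)"
    using feasible_basis_span[OF feas, of "\<lambda>v. A $$ (v, jt)"] by auto
  have "\<exists>v<2 * k. inc v jt"
    using col_cases[OF jt(3)] man_less[of jt] by (auto simp: inc_loop inc_valid intro: exI[of _ "man jt"])
  then obtain v where v: "v < 2 * k" "inc v jt" by blast
  have "\<exists>j\<in>B. y j > 0"
  proof (rule ccontr)
    assume "\<not> ?thesis"
    then have "(\<Sum>j\<in>B. A $$ (v, j) * y j) \<le> 0"
      using v(1) feasible_subset(1)[OF feas]
      by (intro sum_nonpos mult_nonneg_nonpos) (auto simp: A_entry subset_iff not_less)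
    then show False using y[OF v(1)] v jt(3) by (simp add: A_entry)
  qed
  then obtain j where j: "j \<in> B" "y j > 0" "feasible_basis A b (B - {j} \<union> {jt})"
    using ratio_test[of b A B jt y] feas jt y by auto
  have either: "j = i \<or> woman_disliked k MP WP D j"
    using positive_coordinate[OF inv ne t y j(1,2)] disliked_iff_worst[OF D, of _ j]
    by (auto simp: i_def woman_disliked_def)
  have sep: "if u D 0 \<in> {k + 1..k\<^sup>2} then separator k D i else i = 0"
    using separator_iff[OF pair] utility_0_le[OF D] by (auto simp: i_def)
  have cand: "candidate_to_leave A b B jt j" using j by (simp add: candidate_to_leave_def)
  show ?thesis
  proof (cases "candidate_to_leave A b B jt i")
    case True
    then have "leaves k MP WP UNIV B D i"
      unfolding leaves_def using t sep by (intro exI[of _ i] exI[of _ jt]) simp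
    then show ?thesis by blast
  next
    case False
    then have "leaves k MP WP UNIV B D j"
      unfolding leaves_def using t sep cand either by (intro exI[of _ i] exI[of _ jt]) auto
    then show ?thesis by blast
  qed
qed

text \<open>Once every utility over \<open>?E\<close> is at most \<open>k\<^sup>2\<close>, the loop
  of any \<open>v\<close> is not dominated by the other rows, and
  \<open>ordinal_pivot_exists\<close> applies.\<close>

lemma entering_column_exists:
  assumes inv: "scarf_invariant B D" and ne: "B \<noteq> D" and leaves: "leaves k MP WP W B D jl"
    and t: "D - B = {jt}" and B': "B - {jl} \<union> {jt} \<noteq> D"
  shows "\<exists>j'. j' \<notin> D \<and> ordinal_basis C (D - {jl} \<union> {j'})"
proof -
  note pair = invariant_pair[OF inv]
  note D = pair_ordinal[OF pair]
  let ?B' = "B - {jl} \<union> {jt}" and ?E = "D - {jl}"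
  have "B - D = {0}" using inv ne by (auto simp: scarf_invariant_def)
  note BD = eq_exchange[OF this t]
  have "jl \<noteq> 0"
  proof
    assume "jl = 0"
    then show False using B' BD by auto
  qed
  then obtain l where l: "1 \<le> l" "l < 2 * k" "worst C D l = jl"
    using leaves_cases(3)[OF inv leaves t] by blast
  note feas = leaves_cases(1)[OF inv leaves t] and jlB = leaves_cases(2)[OF inv leaves t]
  have B'E: "?B' \<subseteq> insert 0 ?E" using BD(3) jlB t unfolding BD(1) by auto
  have finE: "finite ?E" using ordinal_finite[OF D] by simp
  have small: "u ?E v \<le> k\<^sup>2" if v: "v < 2 * k" for v
  proof (cases "v = 0")
    case False
    obtain j where j: "j \<in> ?B'" "inc v j" using feasible_covers[OF feas v] .
    have "j \<noteq> 0" using j(2) False k inc_loop[of 0 v] by (intro notI) auto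
    then have "j \<in> ?E" using j(1) B'E by auto
    then show ?thesis
      using utility_le[OF finE, of j C v] entry_le_if_inc[OF v _ j(2)] ordinal_num_cols[OF D, of j] k_le_k2
      by auto
  next
    case True
    \<comment> \<open>By cardinality \<open>?E\<close> would consist of all loops but that of man 0.
      The loop of \<open>l\<close> would then be the column that \<open>l\<close> dislikes, which
      has just left.\<close>
    have "\<not> ?E \<subseteq> {1..<2 * k}"
    proof
      assume sub: "?E \<subseteq> {1..<2 * k}"
      have "jl \<in> D" using worst_in[OF D, of l] l by auto
      then have "card ?E = 2 * k - 1" using ordinal_card[OF D] ordinal_finite[OF D] by simp
      then have "?E = {1..<2 * k}" using sub by (intro card_subset_eq) auto
      then have "l \<in> ?E" using l by simp
      then show False using worst_loop[OF pair _ l(2)] l(3) by auto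
    qed
    then obtain j where j: "j \<in> ?E" "j \<notin> {1..<2 * k}" by blast
    then have "j \<noteq> 0" using BD(2) by (intro notI) auto
    then have "j \<in> valid_cols k" using j col_cases[OF ordinal_num_cols[OF D, of j]] by auto
    then show ?thesis using j(1)
      using utility_le[OF finE, of j C v] valid_entry_le[OF v, of j] by simp
  qed
  have "\<exists>j'. j' \<notin> D \<and> ordinal_basis C (D - {worst C D l} \<union> {j'})"
  proof (rule ordinal_pivot_exists[OF D])
    fix v assume "v < dim_row C"
    then have v: "v < 2 * k" by simp
    have "u ?E i < C $$ (i, v)" if "i < 2 * k" "i \<noteq> v" for i
      using small[OF that(1)] C_other_loop_gt[OF that(1) v] that(2) by simp
    then show "\<exists>h<dim_col C. \<forall>i<dim_row C. i \<noteq> v \<longrightarrow> u (D - {worst C D l}) i < C $$ (i, h)"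
      unfolding l(3) using loop_less_num_cols[OF v] by auto
  qed (use l k in auto)
  then show ?thesis unfolding l(3) .
qed

lemma progress:
  assumes inv: "scarf_invariant B D" and ne: "B \<noteq> D"
  shows "\<exists>s'. scarf_iteration k MP WP UNIV (B, D) s'"
proof -
  obtain jt where t: "D - B = {jt}" using inv ne by (auto simp: scarf_invariant_def)
  obtain jl where jl: "leaves k MP WP UNIV B D jl" using some_column_leaves[OF inv ne t] by blast
  show ?thesis
  proof (cases "B - {jl} \<union> {jt} = D")
    case True
    then show ?thesis using scarf_iteration.final[OF ne jl t refl] by blast
  next
    case False
    then show ?thesis
      using scarf_iteration.pivot[OF ne jl t refl False] entering_column_exists[OF inv ne jl t False] by blast
  qed
qed

end

text \<open>Two versions, because a run restricted to valid edges may stop early where only a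
  woman's loop can leave, and then only the bound is available. With these loops allowed a run
  cannot get stuck, so the bound becomes termination with \<open>B = D\<close>.\<close>

theorem theorem7:
  shows "\<exists>c::nat. \<forall>k\<ge>1. \<forall>MP WP. complete_marriage_instance k MP WP \<longrightarrow>
    (\<forall>T s. (scarf_iteration k MP WP (valid_cols k) ^^ T) (scarf_init k MP WP) s \<longrightarrow>
       T \<le> c * (2 * k)\<^sup>2) \<and>
    (\<forall>T s. (scarf_iteration k MP WP UNIV ^^ T) (scarf_init k MP WP) s \<longrightarrow>
       T \<le> c * (2 * k)\<^sup>2 \<and>
       (fst s = snd s \<or> (\<exists>s'. scarf_iteration k MP WP UNIV s s')))"
proof (intro exI[of _ 1] allI impI)
  fix k MP WP assume "1 \<le> k" "complete_marriage_instance k MP WP"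
  then interpret marriage k MP WP by unfold_locales
  show "(\<forall>T s. (scarf_iteration k MP WP (valid_cols k) ^^ T) (scarf_init k MP WP) s \<longrightarrow>
       T \<le> 1 * (2 * k)\<^sup>2) \<and>
    (\<forall>T s. (scarf_iteration k MP WP UNIV ^^ T) (scarf_init k MP WP) s \<longrightarrow>
       T \<le> 1 * (2 * k)\<^sup>2 \<and>
       (fst s = snd s \<or> (\<exists>s'. scarf_iteration k MP WP UNIV s s')))"
  proof (intro conjI allI impI)
    fix T s assume "(scarf_iteration k MP WP (valid_cols k) ^^ T) (scarf_init k MP WP) s"
    then show "T \<le> 1 * (2 * k)\<^sup>2" using run_length_le by (cases s) simp
  next
    fix T s assume run: "(scarf_iteration k MP WP UNIV ^^ T) (scarf_init k MP WP) s"
    obtain B D where s: "s = (B, D)" by (cases s)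
    show "T \<le> 1 * (2 * k)\<^sup>2" using run_length_le run s by simp
    have "scarf_invariant B D" using run_bound run s by blast
    then show "fst s = snd s \<or> (\<exists>s'. scarf_iteration k MP WP UNIV s s')"
      using progress[of B D] s by auto
  qed
qed

end
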